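(* Suppose that the augmented dictionary space $\tilde{\mathbb V}$ is invariant: for every $\phi\in\tilde{\mathbb V}$, every constant control $U\in\mathbb U\times\tilde{\mathbb U}$ and every $t\ge 0$, the function $\xi_0\mapsto\phi(\xi(t;\xi_0,U))$ belongs to $\tilde{\mathbb V}$. Let the training data samples be i.i.d. Then for any $\delta\in(0,1)$ and $\eta>0$ there exists $d_0\in\mathbb N$ such that for all $d\ge d_0$ the augmented system $\dot\xi=F(\xi)+G(\xi)U$ admits the data-driven representation $$\dot\xi=\big(F^\eta(\xi)+\alpha(\xi)\big)+\big(G^\eta(\xi)+\beta(\xi)\big)U,$$ with block-structured errors $$\alpha(\xi)=\begin{bmatrix}\alpha_1(x)\\ \alpha_2(x)^\top y\end{bmatrix},\qquad \beta(\xi)=\begin{bmatrix}\beta_1(x)&0\\0&\beta_2(x)^\top y\end{bmatrix},$$ satisfying $$\|\alpha_1(x)\|\le\eta\|x\|,\qquad \|\alpha_2(x)\|\le\eta,\qquad \|\beta_i(x)\|\le\eta,$$ for all $x\in\Omega$ and $i=1,2$, with probability at least $1-\delta$.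
   Context: Augmented system. $\Omega\subset\mathbb R^n$ is a bounded domain with piecewise smooth boundary. The control-affine system is $\dot x=f(x)+g(x)u$ with unknown $f\in C^2(\Omega)$, $f(0)=0$, $g=[g_1,\dots,g_m]\in C^2(\Omega;\mathbb R^{n\times m})$. The augmented system is $\dot x=f(x)+g(x)u$, $\dot y=\nabla f(x)y+\sum_{i=1}^m\nabla g_i(x)y\,v_i$, where $\nabla f,\nabla g_i$ are Jacobian matrices. With $\xi=[x^\top,y^\top]^\top$, $U=[u^\top,v^\top]^\top$, it reads $\dot\xi=F(\xi)+G(\xi)U$, where $$F(\xi)=\begin{bmatrix}f(x)\\ \nabla f(x)y\end{bmatrix},\quad G(\xi)=\begin{bmatrix}g(x)&0\\0&\nabla g(x)y\end{bmatrix},\quad \nabla g(x)y:=(\nabla g_1(x)y,\dots,\nabla g_m(x)y).$$ Control values satisfy $u\in\mathbb U\subset\mathbb R^m$, $v\in\tilde{\mathbb U}\subset\mathbb R^m$ (domains). $\xi(t;\xi_0,U)$ is the trajectory from $\xi_0$ under the constant control $U$, and $\mathcal L^U\varphi=(F+GU)\cdot\nabla_\xi\varphi$ is the Lie operator. $E_i$ is the $i$-th standard unit vector of $\mathbb R^{2m}$. $Y_a=[-a,a]^n$, $a>0$; samples $\xi=(x,y)$ lie in $\Omega\times Y_a$. Dictionary. $\tilde{\mathbb V}=\operatorname{span}\{1,x^\top,\phi_{n+1}(x),\dots,\phi_N(x),y^\top,\psi_{n+1}(x,y),\dots,\psi_K(x,y)\}$, with $\phi_i(x)=x_i$, $\psi_i(x,y)=y_i$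 for $i\le n$; $\phi_k\in C^2(\bar\Omega)$ with $\phi_k(0)=0$; $\psi_k(x,y)=a_k(x)^\top y$ with $a_k$ smooth. The basis functions are linearly independent. $\Psi(\xi)$ is the column vector of all basis functions, with the constant function $1$ first. EDMD. For each $\bar U\in\{0,E_1,\dots,E_{2m}\}$, draw $d$ i.i.d. points $\omega_1,\dots,\omega_d\in\Omega\times Y_a$. Let $X^{\bar U}$ have columns $\Psi(\omega_j)$ and $Y^{\bar U}$ have columns $(\mathcal L^{\bar U}\Psi)(\omega_j)$; a hat means that the first row (the one of the constant function) is deleted. The least-squares (Frobenius) estimators are $$\mathcal L^0_d=\begin{bmatrix}0&0\\0&S\end{bmatrix},\ S=\hat Y^0(\hat X^0)^\dagger,\qquad \mathcal L^{E_i}_d=\begin{bmatrix}0&0\\ B_{0,i}&\hat B_i\end{bmatrix},\ [B_{0,i},\hat B_i]=\hat Y^{E_i}(X^{E_i})^\dagger,$$ where $\dagger$ is the Moore–Penrose pseudo-inverse. With $P_\xi$ the selection of the coordinates of $\Psi$ equal to $(x,y)$, i.e. $P_\xi\Psi(\xi)=\xi$, set $F^\eta(\xi)=P_\xi\mathcal L^0_d\Psi(\xi)$, and let the $i$-th column of $G^\eta(\xi)$ be $P_\xi(\mathcal L^{E_i}_d-\mathcal L^0_d)\Psi(\xi)$. So $\alpha=F-F^\eta$, $\beta=G-G^\eta$. Block notation: $\alpha_1(x)\in\mathbb R^n$, $\alpha_2(x)\in\mathbb R^{n\times n}$, $\beta_1(x)\in\mathbb R^{n\times m}$, $\beta_2(x)=(\beta_{21}(x),\dots,\beta_{2m}(x))$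 with $\beta_{2j}(x)\in\mathbb R^{n\times n}$, and $\beta_2(x)^\top y:=[\beta_{21}(x)^\top y,\dots,\beta_{2m}(x)^\top y]\in\mathbb R^{n\times m}$.
   Formalization: The sampling law is additionally assumed to give positive probability to every nonempty relatively open subset of Ω×Y_a (as uniform sampling does); for arbitrary i.i.d. laws, e.g. a point mass, the claim is false. *)

theory Defs
  imports "HOL-Probability.Probability" "Jordan_Normal_Form.Matrix"
begin

text \<open>
  Two kinds of vectors and matrices occur. States, controls and system matrices have fixed
  dimensions and use the Cartesian types of \<open>HOL-Analysis\<close>. The dictionary and the data matrices
  have the sizes \<open>1 + N + K\<close> and \<open>d\<close>, which are natural numbers, and use the types \<open>real vec\<close> and
  \<open>real mat\<close> of \<open>Jordan_Normal_Form\<close>. The infix \<open>$\<close> below always selects a component of a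
  Cartesian vector; components of a \<open>real vec\<close> are written with \<open>$v\<close>.
\<close>

no_notation Matrix.vec_index (infixl "$" 100)
notation Matrix.vec_index (infixl "$v" 100)
no_notation Matrix.scalar_prod (infix "\<bullet>" 70)

hide_const (open) Matrix.vec Matrix.mat

primrec Ck_on :: "nat \<Rightarrow> 'a::euclidean_space set \<Rightarrow> ('a \<Rightarrow> 'b::real_normed_vector) \<Rightarrow> bool" where
  "Ck_on 0 S h \<longleftrightarrow> continuous_on S h"
| "Ck_on (Suc k) S h \<longleftrightarrow> (\<forall>x\<in>S. h differentiable (at x)) \<and>
     (\<forall>v. Ck_on k S (\<lambda>x. frechet_derivative h (at x) v))"

definition smooth_on :: "'a::euclidean_space set \<Rightarrow> ('a \<Rightarrow> 'b::real_normed_vector) \<Rightarrow> bool" where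
  "smooth_on S h \<longleftrightarrow> (\<forall>k. Ck_on k S h)"

text \<open>
  The class \<open>C^k\<close> on the closure of an open set \<open>S\<close>: the function is \<open>C^k\<close> in \<open>S\<close> and all its
  derivatives of order at most \<open>k\<close> extend continuously to the closure.
\<close>

definition extends_continuously :: "'a::euclidean_space set \<Rightarrow> ('a \<Rightarrow> 'b::real_normed_vector) \<Rightarrow> bool" where
  "extends_continuously S h \<longleftrightarrow> (\<exists>h'. continuous_on (closure S) h' \<and> (\<forall>x\<in>S. h' x = h x))"

primrec Ck_on_closure :: "nat \<Rightarrow> 'a::euclidean_space set \<Rightarrow> ('a \<Rightarrow> 'b::real_normed_vector) \<Rightarrow> bool" where
  "Ck_on_closure 0 S h \<longleftrightarrow> extends_continuously S h"
| "Ck_on_closure (Suc k) S h \<longleftrightarrow> extends_continuously S h \<and> (\<forall>x\<in>S. h differentiable (at x)) \<and>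
     (\<forall>v. Ck_on_closure k S (\<lambda>x. frechet_derivative h (at x) v))"

definition is_domain :: "'a::euclidean_space set \<Rightarrow> bool" where
  "is_domain S \<longleftrightarrow> open S \<and> connected S \<and> S \<noteq> {}"

text \<open>
  The boundary is a finite union of compact pieces, each contained in a smooth hypersurface
  (a regular level set). No condition is imposed on how the pieces meet, so the usual narrower
  notions (smooth, polyhedral, Lipschitz with smooth faces) are all included.
\<close>

definition piecewise_smooth_boundary :: "'a::euclidean_space set \<Rightarrow> bool" where
  "piecewise_smooth_boundary S \<longleftrightarrow>
     (\<exists>\<Gamma>. finite \<Gamma> \<and> frontier S = \<Union>\<Gamma> \<and>
        (\<forall>P\<in>\<Gamma>. compact P \<and>
           (\<exists>W (h :: 'a \<Rightarrow> real). open W \<and> P \<subseteq> W \<and> smooth_on W h \<and>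
              (\<forall>x\<in>W. \<exists>v. frechet_derivative h (at x) v \<noteq> 0) \<and> (\<forall>x\<in>P. h x = 0))))"

definition joinv :: "real^'p \<Rightarrow> real^'q \<Rightarrow> real^('p + 'q)" where
  "joinv x y = (\<chi> r. case r of Inl i \<Rightarrow> x $ i | Inr j \<Rightarrow> y $ j)"

definition upper :: "real^('p::finite + 'q::finite) \<Rightarrow> real^'p" where
  "upper z = (\<chi> i. z $ Inl i)"

definition lower :: "real^('p::finite + 'q::finite) \<Rightarrow> real^'q" where
  "lower z = (\<chi> j. z $ Inr j)"

definition block_diag :: "real^'c^'p \<Rightarrow> real^'e^'q \<Rightarrow> real^('c + 'e)^('p + 'q)" where
  "block_diag A B = (\<chi> r s. case r of
      Inl i \<Rightarrow> (case s of Inl k \<Rightarrow> A $ i $ k | Inr l \<Rightarrow> 0)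
    | Inr j \<Rightarrow> (case s of Inl k \<Rightarrow> 0 | Inr l \<Rightarrow> B $ j $ l))"

definition joint_set :: "(real^'p) set \<Rightarrow> (real^'q) set \<Rightarrow> (real^('p + 'q)) set" where
  "joint_set A B = {joinv x y | x y. x \<in> A \<and> y \<in> B}"

definition grad_times :: "(real^'n \<Rightarrow> real^'m^'n) \<Rightarrow> real^'n \<Rightarrow> real^'n \<Rightarrow> real^'m^'n" where
  "grad_times g x y = (\<chi> i j. (jacobian (\<lambda>z. column j (g z)) (at x) *v y) $ i)"

definition aug_F :: "(real^'n \<Rightarrow> real^'n) \<Rightarrow> real^('n + 'n) \<Rightarrow> real^('n + 'n)" where
  "aug_F f \<xi> = joinv (f (upper \<xi>)) (jacobian f (at (upper \<xi>)) *v lower \<xi>)"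

definition aug_G :: "(real^'n \<Rightarrow> real^'m^'n) \<Rightarrow> real^('n + 'n) \<Rightarrow> real^('m + 'm)^('n + 'n)" where
  "aug_G g \<xi> = block_diag (g (upper \<xi>)) (grad_times g (upper \<xi>) (lower \<xi>))"

definition aug_trajectory ::
  "(real^'n) set \<Rightarrow> (real^'n \<Rightarrow> real^'n) \<Rightarrow> (real^'n \<Rightarrow> real^'m^'n) \<Rightarrow> real^('m + 'm) \<Rightarrow>
   real^('n + 'n) \<Rightarrow> real \<Rightarrow> (real \<Rightarrow> real^('n + 'n)) \<Rightarrow> bool" where
  "aug_trajectory \<Omega> f g U \<xi>0 t z \<longleftrightarrow> z 0 = \<xi>0 \<and>
     (\<forall>s\<in>{0..t}. z s \<in> joint_set \<Omega> UNIV \<and>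
        (z has_vector_derivative (aug_F f (z s) + aug_G g (z s) *v U)) (at s within {0..t}))"

definition lie_op ::
  "(real^'n \<Rightarrow> real^'n) \<Rightarrow> (real^'n \<Rightarrow> real^'m^'n) \<Rightarrow> real^('m + 'm) \<Rightarrow>
   (real^('n + 'n) \<Rightarrow> real) \<Rightarrow> real^('n + 'n) \<Rightarrow> real" where
  "lie_op f g U \<phi> \<xi> = frechet_derivative \<phi> (at \<xi>) (aug_F f \<xi> + aug_G g \<xi> *v U)"

text \<open>
  \<open>dict N \<phi> a\<close> lists \<open>1, \<phi> 0, \<dots>, \<phi> (N - 1), \<psi> 0, \<dots>, \<psi> (K - 1)\<close> with \<open>\<psi> k (x, y) = a k x \<bullet> y\<close>;
  the functions \<open>\<phi> k\<close> and \<open>\<psi> k\<close> are numbered from \<open>0\<close>. As the coordinates of a vector are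
  indexed by the type \<open>'n\<close>, \<open>coord_pos\<close> numbers them by \<open>0, \<dots>, CARD('n) - 1\<close>.
\<close>

definition coord_pos :: "'n::finite \<Rightarrow> nat" where
  "coord_pos = to_nat_on UNIV"

definition dict ::
  "nat \<Rightarrow> (nat \<Rightarrow> real^'n \<Rightarrow> real) \<Rightarrow> (nat \<Rightarrow> real^'n \<Rightarrow> real^'n) \<Rightarrow> nat \<Rightarrow> real^('n + 'n) \<Rightarrow> real" where
  "dict N \<phi> a l \<xi> =
     (if l = 0 then 1
      else if l \<le> N then \<phi> (l - 1) (upper \<xi>)
      else inner (a (l - 1 - N) (upper \<xi>)) (lower \<xi>))"

abbreviation dict_size :: "nat \<Rightarrow> nat \<Rightarrow> nat" where
  "dict_size N K \<equiv> 1 + N + K"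

definition dict_vec ::
  "nat \<Rightarrow> nat \<Rightarrow> (nat \<Rightarrow> real^'n \<Rightarrow> real) \<Rightarrow> (nat \<Rightarrow> real^'n \<Rightarrow> real^'n) \<Rightarrow> real^('n + 'n) \<Rightarrow> real Matrix.vec" where
  "dict_vec N K \<phi> a \<xi> = Matrix.vec (dict_size N K) (\<lambda>l. dict N \<phi> a l \<xi>)"

definition dict_space ::
  "nat \<Rightarrow> nat \<Rightarrow> (nat \<Rightarrow> real^'n \<Rightarrow> real) \<Rightarrow> (nat \<Rightarrow> real^'n \<Rightarrow> real^'n) \<Rightarrow> (real^('n + 'n) \<Rightarrow> real) set" where
  "dict_space N K \<phi> a = {\<lambda>\<xi>. \<Sum>l<dict_size N K. c l * dict N \<phi> a l \<xi> | c. True}"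

definition dict_independent ::
  "(real^'n) set \<Rightarrow> nat \<Rightarrow> nat \<Rightarrow> (nat \<Rightarrow> real^'n \<Rightarrow> real) \<Rightarrow> (nat \<Rightarrow> real^'n \<Rightarrow> real^'n) \<Rightarrow> bool" where
  "dict_independent \<Omega> N K \<phi> a \<longleftrightarrow>
     (\<forall>c. (\<forall>\<xi>\<in>joint_set \<Omega> UNIV. (\<Sum>l<dict_size N K. c l * dict N \<phi> a l \<xi>) = 0) \<longrightarrow>
          (\<forall>l<dict_size N K. c l = 0))"

text \<open>
  Functions are only compared on \<open>\<Omega> \<times> \<real>\<^sup>n\<close>, where the system lives, and
  \<open>\<phi>(\<xi>(t;\<xi>\<^sub>0,U))\<close> only makes sense for those \<open>\<xi>\<^sub>0\<close> whose trajectory stays in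
  \<open>\<Omega> \<times> \<real>\<^sup>n\<close> up to time \<open>t\<close>. Forward invariance of \<open>\<Omega>\<close> is not presupposed.
\<close>

definition dict_invariant ::
  "(real^'n) set \<Rightarrow> (real^'n \<Rightarrow> real^'n) \<Rightarrow> (real^'n \<Rightarrow> real^'m^'n) \<Rightarrow> (real^('m + 'm)) set \<Rightarrow>
   nat \<Rightarrow> nat \<Rightarrow> (nat \<Rightarrow> real^'n \<Rightarrow> real) \<Rightarrow> (nat \<Rightarrow> real^'n \<Rightarrow> real^'n) \<Rightarrow> bool" where
  "dict_invariant \<Omega> f g \<U> N K \<phi> a \<longleftrightarrow>
     (\<forall>h\<in>dict_space N K \<phi> a. \<forall>U\<in>\<U>. \<forall>t\<ge>0. \<exists>h'\<in>dict_space N K \<phi> a.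
        \<forall>\<xi>0 z. aug_trajectory \<Omega> f g U \<xi>0 t z \<longrightarrow> h (z t) = h' \<xi>0)"

definition is_pseudo_inverse :: "real Matrix.mat \<Rightarrow> real Matrix.mat \<Rightarrow> bool" where
  "is_pseudo_inverse A P \<longleftrightarrow>
     P \<in> carrier_mat (dim_col A) (dim_row A) \<and> A * P * A = A \<and> P * A * P = P \<and>
     transpose_mat (A * P) = A * P \<and> transpose_mat (P * A) = P * A"

definition pseudo_inverse :: "real Matrix.mat \<Rightarrow> real Matrix.mat" where
  "pseudo_inverse A = (THE P. is_pseudo_inverse A P)"

definition hat :: "real Matrix.mat \<Rightarrow> real Matrix.mat" where
  "hat A = Matrix.mat (dim_row A - 1) (dim_col A) (\<lambda>(i, j). A $$ (i + 1, j))"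

definition data_X ::
  "nat \<Rightarrow> nat \<Rightarrow> (nat \<Rightarrow> real^'n \<Rightarrow> real) \<Rightarrow> (nat \<Rightarrow> real^'n \<Rightarrow> real^'n) \<Rightarrow>
   nat \<Rightarrow> (nat \<Rightarrow> real^('n + 'n)) \<Rightarrow> real Matrix.mat" where
  "data_X N K \<phi> a d w = Matrix.mat (dict_size N K) d (\<lambda>(l, j). dict N \<phi> a l (w j))"

definition data_Y ::
  "(real^'n \<Rightarrow> real^'n) \<Rightarrow> (real^'n \<Rightarrow> real^'m^'n) \<Rightarrow>
   nat \<Rightarrow> nat \<Rightarrow> (nat \<Rightarrow> real^'n \<Rightarrow> real) \<Rightarrow> (nat \<Rightarrow> real^'n \<Rightarrow> real^'n) \<Rightarrow>
   real^('m + 'm) \<Rightarrow> nat \<Rightarrow> (nat \<Rightarrow> real^('n + 'n)) \<Rightarrow> real Matrix.mat" where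
  "data_Y f g N K \<phi> a U d w =
     Matrix.mat (dict_size N K) d (\<lambda>(l, j). lie_op f g U (dict N \<phi> a l) (w j))"

text \<open>
  In the following, \<open>w U j\<close> is the \<open>j\<close>-th data point drawn for the control value \<open>U\<close>; only the
  points with \<open>j < d\<close> are used.
\<close>

definition edmd_0 ::
  "(real^'n \<Rightarrow> real^'n) \<Rightarrow> (real^'n \<Rightarrow> real^'m^'n) \<Rightarrow>
   nat \<Rightarrow> nat \<Rightarrow> (nat \<Rightarrow> real^'n \<Rightarrow> real) \<Rightarrow> (nat \<Rightarrow> real^'n \<Rightarrow> real^'n) \<Rightarrow>
   nat \<Rightarrow> (real^('m + 'm) \<Rightarrow> nat \<Rightarrow> real^('n + 'n)) \<Rightarrow> real Matrix.mat" where
  "edmd_0 f g N K \<phi> a d w =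
     four_block_mat (0\<^sub>m 1 1) (0\<^sub>m 1 (N + K)) (0\<^sub>m (N + K) 1)
       (hat (data_Y f g N K \<phi> a 0 d (w 0)) * pseudo_inverse (hat (data_X N K \<phi> a d (w 0))))"

definition edmd_E ::
  "(real^'n \<Rightarrow> real^'n) \<Rightarrow> (real^'n \<Rightarrow> real^'m^'n) \<Rightarrow>
   nat \<Rightarrow> nat \<Rightarrow> (nat \<Rightarrow> real^'n \<Rightarrow> real) \<Rightarrow> (nat \<Rightarrow> real^'n \<Rightarrow> real^'n) \<Rightarrow>
   'm + 'm \<Rightarrow> nat \<Rightarrow> (real^('m + 'm) \<Rightarrow> nat \<Rightarrow> real^('n + 'n)) \<Rightarrow> real Matrix.mat" where
  "edmd_E f g N K \<phi> a i d w =
     0\<^sub>m 1 (dict_size N K) @\<^sub>r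
       (hat (data_Y f g N K \<phi> a (axis i 1) d (w (axis i 1)))
        * pseudo_inverse (data_X N K \<phi> a d (w (axis i 1))))"

definition P_xi :: "nat \<Rightarrow> real Matrix.vec \<Rightarrow> real^('n::finite + 'n)" where
  "P_xi N v = joinv (\<chi> i. v $v (1 + coord_pos i)) (\<chi> i. v $v (1 + N + coord_pos i))"

definition F_eta ::
  "(real^'n \<Rightarrow> real^'n) \<Rightarrow> (real^'n \<Rightarrow> real^'m^'n) \<Rightarrow>
   nat \<Rightarrow> nat \<Rightarrow> (nat \<Rightarrow> real^'n \<Rightarrow> real) \<Rightarrow> (nat \<Rightarrow> real^'n \<Rightarrow> real^'n) \<Rightarrow>
   nat \<Rightarrow> (real^('m + 'm) \<Rightarrow> nat \<Rightarrow> real^('n + 'n)) \<Rightarrow> real^('n + 'n) \<Rightarrow> real^('n + 'n)" where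
  "F_eta f g N K \<phi> a d w \<xi> = P_xi N (edmd_0 f g N K \<phi> a d w *\<^sub>v dict_vec N K \<phi> a \<xi>)"

definition G_eta ::
  "(real^'n \<Rightarrow> real^'n) \<Rightarrow> (real^'n \<Rightarrow> real^'m^'n) \<Rightarrow>
   nat \<Rightarrow> nat \<Rightarrow> (nat \<Rightarrow> real^'n \<Rightarrow> real) \<Rightarrow> (nat \<Rightarrow> real^'n \<Rightarrow> real^'n) \<Rightarrow>
   nat \<Rightarrow> (real^('m + 'm) \<Rightarrow> nat \<Rightarrow> real^('n + 'n)) \<Rightarrow> real^('n + 'n) \<Rightarrow> real^('m + 'm)^('n + 'n)" where
  "G_eta f g N K \<phi> a d w \<xi> =
     (\<chi> r i. P_xi N ((edmd_E f g N K \<phi> a i d w - edmd_0 f g N K \<phi> a d w) *\<^sub>v dict_vec N K \<phi> a \<xi>) $ r)"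

definition sampling_box :: "real \<Rightarrow> (real^'n) set" where
  "sampling_box r = {y. \<forall>i. y $ i \<in> {- r..r}}"

definition edmd_controls :: "(real^('m::finite + 'm)) set" where
  "edmd_controls = insert 0 (range (\<lambda>i. axis i 1))"

definition iid_in :: "'w measure \<Rightarrow> 'a::topological_space set \<Rightarrow> (nat \<Rightarrow> 'w \<Rightarrow> 'a) \<Rightarrow> bool" where
  "iid_in M S X \<longleftrightarrow>
     prob_space.indep_vars M (\<lambda>_. borel) X UNIV \<and>
     (\<forall>j. distr M borel (X j) = distr M borel (X 0)) \<and>
     (\<forall>j. AE \<omega> in M. X j \<omega> \<in> S)"

text \<open>
  Points drawn from \<open>S\<close> reach every part of \<open>S\<close>: each nonempty relatively open subset of \<open>S\<close> has
  positive probability. This holds for the uniform distribution on \<open>\<Omega> \<times> [-r, r]\<^sup>n\<close> and for every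
  distribution with a positive density there. Some such condition is needed: if all the data
  points are, say, equal to one fixed point, the data determine nothing.
\<close>

definition full_support :: "'w measure \<Rightarrow> 'a::topological_space set \<Rightarrow> ('w \<Rightarrow> 'a) \<Rightarrow> bool" where
  "full_support M S Z \<longleftrightarrow>
     (\<forall>W. open W \<and> W \<inter> S \<noteq> {} \<longrightarrow> measure M {\<omega>\<in>space M. Z \<omega> \<in> W} > 0)"

text \<open>
  \<open>\<beta>\<^sub>2(x)\<close> is the tuple of the matrices \<open>\<beta>\<^sub>2\<^sub>j(x)\<close>. The norm of a matrix, and of such a tuple, is
  that of its Cartesian type, i.e. the Frobenius norm (of the concatenated matrix); it dominates the
  spectral norm.
\<close>

definition tuple_transpose_times :: "real^'n^'n^'m \<Rightarrow> real^'n \<Rightarrow> real^'m^'n" where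
  "tuple_transpose_times B y = (\<chi> i j. (Finite_Cartesian_Product.transpose (B $ j) *v y) $ i)"

end

theory Submission
  imports Defs
begin

text \<open>
  The estimation errors vanish. If the dictionary space is invariant under the flows, then it is
  invariant under every Lie operator \<open>\<L>\<^sup>U\<close>, so \<open>\<L>\<^sup>U \<Psi> = L \<Psi>\<close> holds exactly with a constant matrix
  \<open>L\<close>. The regression data then satisfy \<open>Y = L X\<close> without noise, and the least-squares
  estimator \<open>Y X\<^sup>\<dagger> = L X X\<^sup>\<dagger>\<close> equals \<open>L\<close> as soon as the data matrix \<open>X\<close> has full row rank. So
  probability enters only through the rank of \<open>X\<close>, and the representation holds with
  \<open>\<alpha> = 0\<close> and \<open>\<beta> = 0\<close>.

  Passing from flows to Lie operators needs two things. First, trajectories must exist for a short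
  time from every point of \<open>\<Omega> \<times> \<real>\<^sup>n\<close>. The functions \<open>f\<close> and \<open>g\<close> are of class \<open>C\<^sup>2\<close>, hence the
  augmented field is locally Lipschitz, and a contraction argument applies
  (\<open>aug_trajectory_exists\<close>). Second, the derivative at \<open>t = 0\<close> of a curve in the dictionary space
  must again belong to that space although the curve is known only pointwise: a span of finitely many
  functions is closed under pointwise limits (\<open>span_closed_under_pointwise_limits\<close>). This
  gives \<open>\<L>\<^sup>U\<close> for the admissible controls; these form an open set and \<open>\<L>\<^sup>U\<close> is affine in \<open>U\<close>, so the
  controls \<open>0\<close> and \<open>E\<^sub>i\<close> of the regression are covered even if they are not admissible
  (\<open>lie_op_dict_in_span\<close>). For the control \<open>0\<close> the estimator leaves out the constant function; this
  loses nothing, because \<open>f 0 = 0\<close> and all other dictionary functions vanish at \<open>0\<close>, which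
  forces the constant coefficients to be zero (\<open>edmd_0_exact\<close>).

  Full row rank of \<open>X\<close> means that the dictionary is linearly independent on the sample. Since the
  dictionary is independent on \<open>\<Omega> \<times> [-r, r]\<^sup>n\<close> and continuous, there are finitely many open
  sets such that every sample that hits each of them has this property
  (\<open>independence_witnessed_by_open_sets\<close>). Each of these sets has positive probability, so i.i.d.
  points miss one of them with a probability that decays geometrically in the sample size
  (\<open>iid_samples_hit_open_sets\<close>).

  The linear algebra, both for the limits and for the rank, rests on one elementary fact: linearly
  independent functions admit a dual basis made of combinations of point evaluations
  (\<open>point_evaluation_dual_basis\<close>).
\<close>

section \<open>Finitely many points determine a function in a finite-dimensional space\<close>

definition independent_on :: "'a set \<Rightarrow> nat \<Rightarrow> (nat \<Rightarrow> 'a \<Rightarrow> real) \<Rightarrow> bool" where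
  "independent_on S p b \<longleftrightarrow>
     (\<forall>c. (\<forall>x\<in>S. (\<Sum>l<p. c l * b l x) = 0) \<longrightarrow> (\<forall>l<p. c l = 0))"

lemma independent_on_fewer:
  assumes "independent_on S (Suc p) b"
  shows "independent_on S p b"
  unfolding independent_on_def
proof (intro allI impI)
  fix c l assume c: "\<forall>x\<in>S. (\<Sum>l<p. c l * b l x) = 0" and l: "l < p"
  have "\<forall>x\<in>S. (\<Sum>l<Suc p. (if l < p then c l else 0) * b l x) = 0"
    using c by simp
  with assms have "\<forall>l<Suc p. (if l < p then c l else 0) = 0"
    unfolding independent_on_def by (elim allE[of _ "\<lambda>l. if l < p then c l else 0"]) blast
  with l show "c l = 0" by (metis less_Suc_eq)
qed

text \<open>
  By induction on the number of functions, as in Gram--Schmidt: the part of the new function that the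
  old functionals do not see is nonzero at some point \<open>z\<close>, and evaluation at \<open>z\<close>, corrected to
  vanish on the old functions, is the functional dual to the new one.
\<close>
lemma point_evaluation_dual_basis:
  assumes "independent_on S p b"
  obtains T B where "finite T" "T \<subseteq> S"
    "\<And>l k. l < p \<Longrightarrow> k < p \<Longrightarrow> (\<Sum>x\<in>T. B l x * b k x) = (if l = k then 1 else 0)"
proof -
  have "\<exists>T B. finite T \<and> T \<subseteq> S \<and>
      (\<forall>l<p. \<forall>k<p. (\<Sum>x\<in>T. B l x * b k x) = (if l = k then 1 else (0::real)))"
    using assms
  proof (induction p)
    case 0
    show ?case by (intro exI[of _ "{}"]) simp
  next
    case (Suc p)
    obtain T B where T: "finite T" "T \<subseteq> S"
      and B: "\<And>l k. l < p \<Longrightarrow> k < p \<Longrightarrow> (\<Sum>x\<in>T. B l x * b k x) = (if l = k then 1 else (0::real))"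
      using Suc.IH[OF independent_on_fewer[OF Suc.prems]] by blast
    \<comment> \<open>The remainder of \<open>b p\<close> after its projection along the functionals found so far.\<close>
    define e where "e k = (\<Sum>x\<in>T. B k x * b p x)" for k
    define h where "h x = b p x - (\<Sum>k<p. e k * b k x)" for x
    have "\<exists>z\<in>S. h z \<noteq> 0"
    proof (rule ccontr)
      assume "\<not> ?thesis"
      then have "\<forall>x\<in>S. (\<Sum>l<Suc p. (if l < p then - e l else 1) * b l x) = 0"
        by (simp add: h_def sum_negf)
      then have "\<forall>l<Suc p. (if l < p then - e l else 1) = 0"
        using Suc.prems unfolding independent_on_def
        by (elim allE[of _ "\<lambda>l. if l < p then - e l else 1"]) blast
      then show False by (metis less_Suc_eq less_irrefl zero_neq_one)
    qed
    then obtain z where z: "z \<in> S" "h z \<noteq> 0" by blast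
    define T' where "T' = insert z T"
    define B0 where "B0 l x = (if x \<in> T then B l x else 0)" for l x
    define \<mu> where "\<mu> x = (if x = z then 1 / h z else 0) - (\<Sum>k<p. b k z / h z * B0 k x)" for x
    define B' where "B' l x = (if l < p then B0 l x - e l * \<mu> x else \<mu> x)" for l x
    have fin: "finite T'" using T by (simp add: T'_def)
    have B0: "(\<Sum>x\<in>T'. B0 l x * q x) = (\<Sum>x\<in>T. B l x * q x)" for l q
    proof -
      have "(\<Sum>x\<in>T'. B0 l x * q x) = (\<Sum>x\<in>T. B0 l x * q x)"
        using T unfolding T'_def B0_def by (intro sum.mono_neutral_right) auto
      then show ?thesis by (simp add: B0_def)
    qed
    have \<mu>: "(\<Sum>x\<in>T'. \<mu> x * q x) = q z / h z - (\<Sum>k<p. b k z / h z * (\<Sum>x\<in>T. B k x * q x))" for q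
    proof -
      have "(\<Sum>x\<in>T'. \<mu> x * q x) = (\<Sum>x\<in>T'. (if x = z then 1 / h z else 0) * q x)
          - (\<Sum>x\<in>T'. \<Sum>k<p. b k z / h z * (B0 k x * q x))"
        by (simp add: \<mu>_def left_diff_distrib sum_subtractf sum_distrib_right mult.assoc)
      also have "(\<Sum>x\<in>T'. (if x = z then 1 / h z else 0) * q x) = q z / h z"
        using fin by (simp add: T'_def if_distrib[of "\<lambda>t. t * _"] cong: if_cong)
      also have "(\<Sum>x\<in>T'. \<Sum>k<p. b k z / h z * (B0 k x * q x))
          = (\<Sum>k<p. b k z / h z * (\<Sum>x\<in>T'. B0 k x * q x))"
        by (subst sum.swap) (simp add: sum_distrib_left)
      finally show ?thesis by (simp add: B0)
    qed
    have \<mu>_old: "(\<Sum>x\<in>T'. \<mu> x * b k x) = 0" if "k < p" for k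
      using that by (simp add: \<mu> B if_distrib[of "\<lambda>t. _ * t"] cong: if_cong)
    have \<mu>_new: "(\<Sum>x\<in>T'. \<mu> x * b p x) = 1"
    proof -
      have "(\<Sum>x\<in>T'. \<mu> x * b p x) = (b p z - (\<Sum>k<p. e k * b k z)) / h z"
        by (simp add: \<mu> e_def[symmetric] diff_divide_distrib sum_divide_distrib mult.commute)
      then show ?thesis using z(2) by (simp add: h_def)
    qed
    have B'_old: "(\<Sum>x\<in>T'. B' l x * q x) = (\<Sum>x\<in>T. B l x * q x) - e l * (\<Sum>x\<in>T'. \<mu> x * q x)"
      if "l < p" for l q
      using that
      by (simp add: B'_def left_diff_distrib sum_subtractf B0 mult.assoc sum_distrib_left)
    have "(\<Sum>x\<in>T'. B' l x * b k x) = (if l = k then 1 else 0)" if "l < Suc p" "k < Suc p" for l k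
    proof (cases "l < p")
      case True
      show ?thesis
      proof (cases "k < p")
        case True
        then show ?thesis using \<open>l < p\<close> by (simp add: B'_old \<mu>_old B)
      next
        case False
        then have "k = p" using that by simp
        then show ?thesis using \<open>l < p\<close> by (simp add: B'_old \<mu>_new e_def)
      qed
    next
      case False
      then have "l = p" using that by simp
      then show ?thesis using that \<mu>_old \<mu>_new by (cases "k < p") (auto simp: B'_def less_Suc_eq)
    qed
    then show ?case
      using fin T z(1) by (intro exI[of _ T'] exI[of _ B']) (auto simp: T'_def)
  qed
  then show thesis using that by blast
qed

text \<open>
  The dual basis expresses each coefficient by finitely many function values, so pointwise
  convergence forces the coefficients to converge.
\<close>
lemma span_closed_under_pointwise_limits:
  assumes ind: "independent_on S p b" and F: "F \<noteq> bot"
    and q: "\<And>x. x \<in> S \<Longrightarrow> eventually (\<lambda>t. q t x = (\<Sum>l<p. c t l * b l x)) F"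
    and lim: "\<And>x. x \<in> S \<Longrightarrow> ((\<lambda>t. q t x) \<longlongrightarrow> D x) F"
  shows "\<exists>c. \<forall>x\<in>S. D x = (\<Sum>l<p. c l * b l x)"
proof -
  obtain T B where T: "finite T" "T \<subseteq> S"
    and B: "\<And>l k. l < p \<Longrightarrow> k < p \<Longrightarrow> (\<Sum>x\<in>T. B l x * b k x) = (if l = k then 1 else 0)"
    using point_evaluation_dual_basis[OF ind] by blast
  define c' where "c' l = (\<Sum>x\<in>T. B l x * D x)" for l
  have c: "((\<lambda>t. c t l) \<longlongrightarrow> c' l) F" if l: "l < p" for l
  proof -
    have "((\<lambda>t. \<Sum>x\<in>T. B l x * q t x) \<longlongrightarrow> c' l) F"
      unfolding c'_def using T by (intro tendsto_sum tendsto_mult_left lim) auto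
    moreover have "eventually (\<lambda>t. (\<Sum>x\<in>T. B l x * q t x) = c t l) F"
    proof -
      have "eventually (\<lambda>t. \<forall>x\<in>T. q t x = (\<Sum>k<p. c t k * b k x)) F"
        using T q by (subst eventually_ball_finite_distrib) auto
      then show ?thesis
      proof eventually_elim
        case (elim t)
        have "(\<Sum>x\<in>T. B l x * q t x) = (\<Sum>x\<in>T. \<Sum>k<p. c t k * (B l x * b k x))"
          using elim by (simp add: sum_distrib_left mult.left_commute)
        also have "\<dots> = (\<Sum>k<p. c t k * (\<Sum>x\<in>T. B l x * b k x))"
          by (subst sum.swap) (simp add: sum_distrib_left)
        also have "\<dots> = c t l"
          using l by (simp add: B if_distrib[of "\<lambda>t. _ * t"] cong: if_cong)
        finally show ?case .
      qed
    qed
    ultimately show ?thesis by (rule Lim_transform_eventually)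
  qed
  have "D x = (\<Sum>l<p. c' l * b l x)" if x: "x \<in> S" for x
  proof -
    have "((\<lambda>t. \<Sum>l<p. c t l * b l x) \<longlongrightarrow> (\<Sum>l<p. c' l * b l x)) F"
      by (intro tendsto_sum tendsto_mult_right c) auto
    moreover have "((\<lambda>t. \<Sum>l<p. c t l * b l x) \<longlongrightarrow> D x) F"
      using lim[OF x] q[OF x] by (rule Lim_transform_eventually)
    ultimately show ?thesis using F tendsto_unique by blast
  qed
  then show ?thesis by blast
qed

text \<open>
  If the points of a dual basis are moved slightly, the matrix of functionals against functions stays
  close to the identity and therefore stays injective. The sets \<open>W x\<close> are the admissible
  displacements of the points.
\<close>
lemma independence_witnessed_by_open_sets:
  fixes b :: "nat \<Rightarrow> 'a::metric_space \<Rightarrow> real"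
  assumes ind: "independent_on S p b"
    and cont: "\<And>l x. l < p \<Longrightarrow> x \<in> S \<Longrightarrow> isCont (b l) x"
  obtains T W where "finite T" "T \<subseteq> S" "\<And>x. x \<in> T \<Longrightarrow> open (W x) \<and> x \<in> W x"
    "\<And>Z. (\<And>x. x \<in> T \<Longrightarrow> \<exists>z\<in>Z. z \<in> W x) \<Longrightarrow> independent_on Z p b"
proof -
  obtain T B where T: "finite T" "T \<subseteq> S"
    and B: "\<And>l k. l < p \<Longrightarrow> k < p \<Longrightarrow> (\<Sum>x\<in>T. B l x * b k x) = (if l = k then 1 else 0)"
    using point_evaluation_dual_basis[OF ind] by blast
  define R where "R = 1 + (\<Sum>l<p. \<Sum>x\<in>T. \<bar>B l x\<bar>)"
  have R: "R \<ge> 1" unfolding R_def by (simp add: sum_nonneg)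
  \<comment> \<open>With this tolerance, a coefficient vector \<open>c\<close> whose combination vanishes on \<open>Z\<close> satisfies
    \<open>s \<le> (R - 1) \<epsilon> s \<le> s / 2\<close> for its \<open>\<ell>\<^sup>1\<close> norm \<open>s\<close>, which forces \<open>s = 0\<close>.\<close>
  define \<epsilon> where "\<epsilon> = 1 / (2 * R)"
  have \<epsilon>: "\<epsilon> > 0" using R by (simp add: \<epsilon>_def)
  have "\<exists>W. open W \<and> x \<in> W \<and> (\<forall>z\<in>W. \<forall>k<p. \<bar>b k z - b k x\<bar> \<le> \<epsilon>)" if x: "x \<in> T" for x
  proof -
    have "eventually (\<lambda>z. \<bar>b k z - b k x\<bar> \<le> \<epsilon>) (nhds x)" if "k < p" for k
    proof -
      have "(b k \<longlongrightarrow> b k x) (nhds x)"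
        using cont[OF that] x T by (metis isCont_def subsetD tendsto_at_iff_tendsto_nhds)
      from tendstoD[OF this \<epsilon>] show ?thesis
        by eventually_elim (simp add: dist_real_def)
    qed
    then have "eventually (\<lambda>z. \<forall>k\<in>{..<p}. \<bar>b k z - b k x\<bar> \<le> \<epsilon>) (nhds x)"
      by (subst eventually_ball_finite_distrib) auto
    then show ?thesis unfolding eventually_nhds by auto
  qed
  then obtain W where W: "\<And>x. x \<in> T \<Longrightarrow> open (W x) \<and> x \<in> W x"
    and close: "\<And>x z k. x \<in> T \<Longrightarrow> z \<in> W x \<Longrightarrow> k < p \<Longrightarrow> \<bar>b k z - b k x\<bar> \<le> \<epsilon>"
    by metis
  show thesis
  proof (rule that[OF T W])
    fix Z assume "\<And>x. x \<in> T \<Longrightarrow> \<exists>z\<in>Z. z \<in> W x"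
    then obtain \<zeta> where \<zeta>: "\<And>x. x \<in> T \<Longrightarrow> \<zeta> x \<in> Z \<and> \<zeta> x \<in> W x" by metis
    show "independent_on Z p b"
      unfolding independent_on_def
    proof (rule allI, rule impI)
      fix c assume c: "\<forall>z\<in>Z. (\<Sum>k<p. c k * b k z) = 0"
      define s where "s = (\<Sum>k<p. \<bar>c k\<bar>)"
      have s0: "s \<ge> 0" by (simp add: s_def sum_nonneg)
      have dev: "\<bar>\<Sum>k<p. c k * b k x\<bar> \<le> \<epsilon> * s" if x: "x \<in> T" for x
      proof -
        have "(\<Sum>k<p. c k * b k x) = - (\<Sum>k<p. c k * (b k (\<zeta> x) - b k x))"
          using c \<zeta>[OF x] by (simp add: right_diff_distrib sum_subtractf)
        also have "\<bar>\<dots>\<bar> \<le> (\<Sum>k<p. \<bar>c k * (b k (\<zeta> x) - b k x)\<bar>)"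
          by simp
        also have "\<dots> \<le> (\<Sum>k<p. \<bar>c k\<bar> * \<epsilon>)"
          using close[OF x] \<zeta>[OF x] by (intro sum_mono) (auto simp: abs_mult intro!: mult_left_mono)
        finally show ?thesis by (simp add: s_def sum_distrib_left mult.commute)
      qed
      have cl: "\<bar>c l\<bar> \<le> (\<Sum>x\<in>T. \<bar>B l x\<bar>) * (\<epsilon> * s)" if l: "l < p" for l
      proof -
        have "(\<Sum>x\<in>T. B l x * (\<Sum>k<p. c k * b k x)) = (\<Sum>x\<in>T. \<Sum>k<p. c k * (B l x * b k x))"
          by (simp add: sum_distrib_left mult.left_commute)
        also have "\<dots> = (\<Sum>k<p. c k * (\<Sum>x\<in>T. B l x * b k x))"
          by (subst sum.swap) (simp add: sum_distrib_left)
        also have "\<dots> = c l"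
          using l by (simp add: B if_distrib[of "\<lambda>t. _ * t"] cong: if_cong)
        finally have "\<bar>c l\<bar> = \<bar>\<Sum>x\<in>T. B l x * (\<Sum>k<p. c k * b k x)\<bar>" by simp
        also have "\<dots> \<le> (\<Sum>x\<in>T. \<bar>B l x * (\<Sum>k<p. c k * b k x)\<bar>)"
          by simp
        also have "\<dots> \<le> (\<Sum>x\<in>T. \<bar>B l x\<bar> * (\<epsilon> * s))"
          using dev by (intro sum_mono) (auto simp: abs_mult intro!: mult_left_mono)
        finally show ?thesis by (simp add: sum_distrib_right)
      qed
      have "s \<le> (\<Sum>l<p. (\<Sum>x\<in>T. \<bar>B l x\<bar>) * (\<epsilon> * s))"
        unfolding s_def by (intro sum_mono) (use cl in \<open>auto simp: s_def\<close>)
      also have "\<dots> = (R - 1) * (\<epsilon> * s)"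
        by (simp add: R_def sum_distrib_right)
      also have "\<dots> \<le> R * (\<epsilon> * s)"
        using \<epsilon> s0 by (intro mult_right_mono) auto
      also have "\<dots> = s / 2"
        using R by (simp add: \<epsilon>_def)
      finally have "s = 0" using s0 by simp
      then show "\<forall>l<p. c l = 0"
        unfolding s_def by (subst (asm) sum_nonneg_eq_0_iff) auto
    qed
  qed
qed

lemma independent_on_tail:
  assumes "independent_on S (Suc n) b"
  shows "independent_on S n (\<lambda>l. b (Suc l))"
  unfolding independent_on_def
proof (rule allI, rule impI)
  fix c assume c: "\<forall>x\<in>S. (\<Sum>l<n. c l * b (Suc l) x) = 0"
  let ?c = "case_nat 0 c"
  have "\<forall>x\<in>S. (\<Sum>l<Suc n. ?c l * b l x) = 0"
    using c by (simp only: sum.lessThan_Suc_shift) simp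
  then have "\<forall>l<Suc n. ?c l = 0"
    using assms unfolding independent_on_def by (elim allE[of _ ?c]) blast
  then show "\<forall>l<n. c l = 0" by fastforce
qed

lemma sum_unit_coefficient:
  fixes q :: "nat \<Rightarrow> real"
  assumes "l < n"
  shows "(\<Sum>k<n. (if k = l then 1 else 0) * q k) = q l"
  using assms by (simp add: if_distrib[of "\<lambda>t. t * _"] cong: if_cong)

section \<open>Short-time solutions of Lipschitz differential equations\<close>

text \<open>
  Picard iteration. The unknown is a bounded continuous function on all of \<open>\<real>\<close>, a complete space;
  the integral operator stops the clock outside of \<open>[0, \<tau>]\<close> so as to map this space into itself.
\<close>
lemma local_solution_of_lipschitz_ode:
  fixes \<Phi> :: "'a::euclidean_space \<Rightarrow> 'a"
  assumes \<epsilon>: "\<epsilon> > 0" and lip: "L-lipschitz_on (cball x0 \<epsilon>) \<Phi>"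
  obtains \<tau> z where "\<tau> > 0" "z 0 = x0"
    "\<And>s. s \<in> {0..\<tau>} \<Longrightarrow> z s \<in> cball x0 \<epsilon> \<and>
       (z has_vector_derivative \<Phi> (z s)) (at s within {0..\<tau>})"
proof -
  let ?C = "cball x0 \<epsilon>"
  have C: "convex ?C" "closed ?C" "?C \<noteq> {}" using \<epsilon> by auto
  have L: "L \<ge> 0" using lip by (rule lipschitz_on_nonneg)
  have "bounded (\<Phi> ` ?C)"
    using lipschitz_on_continuous_on[OF lip] by (intro compact_imp_bounded compact_continuous_image) auto
  then obtain B where B: "B > 0" "\<And>x. x \<in> ?C \<Longrightarrow> norm (\<Phi> x) \<le> B"
    by (auto simp: bounded_pos)
  define \<tau> where "\<tau> = min (\<epsilon> / B) (1 / (2 * (L + 1)))"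
  have \<tau>: "\<tau> > 0" "B * \<tau> \<le> \<epsilon>" "L * \<tau> \<le> 1 / 2"
  proof -
    show "\<tau> > 0" using \<epsilon> B L by (simp add: \<tau>_def)
    have "B * \<tau> \<le> B * (\<epsilon> / B)" using B by (intro mult_left_mono) (auto simp: \<tau>_def)
    then show "B * \<tau> \<le> \<epsilon>" using B by simp
    have "L * \<tau> \<le> (L + 1) * (1 / (2 * (L + 1)))"
      using L \<open>\<tau> > 0\<close> by (intro mult_mono) (auto simp: \<tau>_def)
    also have "\<dots> = 1 / 2" using L by (simp add: field_simps)
    finally show "L * \<tau> \<le> 1 / 2" .
  qed
  \<comment> \<open>Precomposing with the projection onto the ball makes the field bounded and Lipschitz on the
    whole space; up to time \<open>\<tau>\<close> the solution cannot leave the ball, where nothing was changed.\<close>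
  define \<Psi> where "\<Psi> x = \<Phi> (closest_point ?C x)" for x
  have cp: "closest_point ?C x \<in> ?C" for x using C by (intro closest_point_in_set)
  have \<Psi>_bound: "norm (\<Psi> x) \<le> B" for x using B(2)[OF cp] by (simp add: \<Psi>_def)
  have \<Psi>_lip: "dist (\<Psi> x) (\<Psi> y) \<le> L * dist x y" for x y
  proof -
    have "dist (\<Psi> x) (\<Psi> y) \<le> L * dist (closest_point ?C x) (closest_point ?C y)"
      unfolding \<Psi>_def by (rule lipschitz_onD[OF lip cp cp])
    also have "\<dots> \<le> L * dist x y" using closest_point_lipschitz[OF C] L by (rule mult_left_mono)
    finally show ?thesis .
  qed
  have \<Psi>_cont: "continuous_on S \<Psi>" for S
    using \<Psi>_lip L by (intro lipschitz_on_continuous_on[of L] lipschitz_onI) auto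
  define cl where "cl t = max 0 (min \<tau> t)" for t
  have cl: "cl t \<in> {0..\<tau>}" for t using \<tau> by (auto simp: cl_def)
  define P where "P z t = x0 + integral {0..cl t} (\<lambda>s. \<Psi> (apply_bcontfun z s))" for z :: "real \<Rightarrow>\<^sub>C 'a" and t
  have \<Psi>z: "continuous_on S (\<lambda>s. \<Psi> (apply_bcontfun z s))" for S and z :: "real \<Rightarrow>\<^sub>C 'a"
    by (rule continuous_on_compose2[OF \<Psi>_cont[of UNIV]]) auto
  have P_close: "norm (P z t - x0) \<le> B * \<tau>" for z t
  proof -
    have "norm (P z t - x0) \<le> B * (cl t - 0)"
      unfolding P_def using \<Psi>_bound cl[of t] by (simp, intro integral_bound[where a=0, simplified] \<Psi>z) auto
    also have "\<dots> \<le> B * \<tau>" using cl[of t] B by (intro mult_left_mono) auto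
    finally show ?thesis .
  qed
  have P_bcont: "P z \<in> bcontfun" for z
  proof (rule bcontfun_normI)
    have "continuous_on {0..\<tau>} (\<lambda>t. integral {0..t} (\<lambda>s. \<Psi> (apply_bcontfun z s)))"
      by (intro indefinite_integral_continuous_1 integrable_continuous_real \<Psi>z)
    then have "continuous_on UNIV (\<lambda>t. integral {0..cl t} (\<lambda>s. \<Psi> (apply_bcontfun z s)))"
      by (rule continuous_on_compose2) (use cl in \<open>auto simp: cl_def intro!: continuous_intros\<close>)
    then show "continuous_on UNIV (P z)"
      unfolding P_def by (intro continuous_intros)
    show "norm (P z t) \<le> norm x0 + B * \<tau>" for t
      using P_close[of z t] norm_triangle_ineq[of x0 "P z t - x0"] by simp
  qed
  have "\<exists>!z. Bcontfun (P z) = z"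
  proof (rule banach_fix_type[of "1/2"])
    show "\<forall>z z'. dist (Bcontfun (P z)) (Bcontfun (P z')) \<le> 1 / 2 * dist z z'"
    proof (intro allI dist_bound)
      fix z z' t
      have "dist (P z t) (P z' t)
          = norm (integral {0..cl t} (\<lambda>s. \<Psi> (apply_bcontfun z s) - \<Psi> (apply_bcontfun z' s)))"
        unfolding P_def dist_norm
        by (subst integral_diff) (auto intro!: integrable_continuous_real \<Psi>z)
      also have "\<dots> \<le> (L * dist z z') * (cl t - 0)"
      proof (rule integral_bound)
        show "norm (\<Psi> (apply_bcontfun z s) - \<Psi> (apply_bcontfun z' s)) \<le> L * dist z z'" for s
          using \<Psi>_lip L dist_bounded[of z _ z']
          by (metis dist_norm mult_left_mono order_trans)
      qed (use cl[of t] in \<open>auto intro!: continuous_intros \<Psi>z\<close>)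
      also have "\<dots> \<le> (L * dist z z') * \<tau>"
        using cl[of t] L by (intro mult_left_mono) auto
      also have "\<dots> \<le> 1 / 2 * dist z z'"
        using \<tau>(3) mult_right_mono[of "L * \<tau>" "1/2" "dist z z'"] by (simp add: mult.commute mult.left_commute)
      finally show "dist (apply_bcontfun (Bcontfun (P z)) t) (apply_bcontfun (Bcontfun (P z')) t)
          \<le> 1 / 2 * dist z z'"
        by (simp add: Bcontfun_inverse[OF P_bcont])
    qed
  qed auto
  then obtain z where "Bcontfun (P z) = z" by blast
  then have z: "apply_bcontfun z t = P z t" for t
    using Bcontfun_inverse[OF P_bcont[of z]] by simp
  show thesis
  proof (rule that[of \<tau> "apply_bcontfun z"])
    show "apply_bcontfun z 0 = x0" using \<tau> by (subst z) (simp add: P_def cl_def)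
    fix s assume s: "s \<in> {0..\<tau>}"
    have in_C: "apply_bcontfun z s \<in> ?C"
      using P_close[of z s] \<tau>(2) by (subst z) (simp add: dist_norm norm_minus_commute)
    have "((\<lambda>t. x0 + integral {0..t} (\<lambda>s. \<Psi> (apply_bcontfun z s))) has_vector_derivative
        0 + \<Psi> (apply_bcontfun z s)) (at s within {0..\<tau>})"
      by (intro has_vector_derivative_add has_vector_derivative_const integral_has_vector_derivative \<Psi>z s)
    moreover have "apply_bcontfun z t = x0 + integral {0..t} (\<lambda>s. \<Psi> (apply_bcontfun z s))"
      if "t \<in> {0..\<tau>}" for t
      using that by (subst z) (simp add: P_def cl_def)
    ultimately have "(apply_bcontfun z has_vector_derivative 0 + \<Psi> (apply_bcontfun z s)) (at s within {0..\<tau>})"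
      by (rule has_vector_derivative_transform[OF s, rotated])
    then show "apply_bcontfun z s \<in> ?C \<and>
        (apply_bcontfun z has_vector_derivative \<Phi> (apply_bcontfun z s)) (at s within {0..\<tau>})"
      using in_C closest_point_self[OF in_C] by (simp add: \<Psi>_def)
  qed (rule \<tau>)
qed

text \<open>
  The radius is left open because it shrinks under composition, when the inner function has to stay
  in the ball belonging to the outer one.
\<close>
definition lipschitz_near :: "'a::metric_space \<Rightarrow> ('a \<Rightarrow> 'b::metric_space) \<Rightarrow> bool" where
  "lipschitz_near x h \<longleftrightarrow> (\<exists>\<epsilon>>0. \<exists>L. L-lipschitz_on (cball x \<epsilon>) h)"

lemma lipschitz_near_on_open:
  assumes "lipschitz_near x h" "open S" "x \<in> S" "\<And>z. z \<in> S \<Longrightarrow> h' z = h z"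
  obtains \<epsilon> L where "\<epsilon> > 0" "cball x \<epsilon> \<subseteq> S" "L-lipschitz_on (cball x \<epsilon>) h'"
proof -
  obtain \<epsilon>1 L where 1: "\<epsilon>1 > 0" "L-lipschitz_on (cball x \<epsilon>1) h"
    using assms(1) by (auto simp: lipschitz_near_def)
  obtain \<epsilon>2 where 2: "\<epsilon>2 > 0" "cball x \<epsilon>2 \<subseteq> S"
    using assms(2,3) open_contains_cball by blast
  have "L-lipschitz_on (cball x (min \<epsilon>1 \<epsilon>2)) h"
    using 1(2) by (rule lipschitz_on_subset) auto
  moreover have sub: "cball x (min \<epsilon>1 \<epsilon>2) \<subseteq> S" using 2 by auto
  ultimately have "L-lipschitz_on (cball x (min \<epsilon>1 \<epsilon>2)) h'"
    using assms(4) sub by (auto simp: lipschitz_on_def subset_iff)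
  then show thesis using 1 2 sub that[of "min \<epsilon>1 \<epsilon>2"] by auto
qed

lemma lipschitz_near_const: "lipschitz_near x (\<lambda>_. c)"
  unfolding lipschitz_near_def lipschitz_on_def by (intro exI[of _ 1] conjI exI[of _ 0]) auto

lemma lipschitz_near_bounded_linear:
  assumes "bounded_linear h"
  shows "lipschitz_near x h"
proof -
  have "(onorm h)-lipschitz_on (cball x 1) h"
  proof (rule lipschitz_onI)
    show "dist (h z) (h z') \<le> onorm h * dist z z'" for z z'
      using onorm[OF assms, of "z - z'"] bounded_linear.linear[OF assms]
      by (simp add: dist_norm linear_diff)
  qed (rule onorm_pos_le[OF assms])
  then show ?thesis unfolding lipschitz_near_def by (intro exI[of _ 1]) auto
qed

lemma lipschitz_near_compose:
  assumes "lipschitz_near (k x) h" "lipschitz_near x k"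
  shows "lipschitz_near x (\<lambda>z. h (k z))"
proof -
  obtain \<epsilon> L where h: "\<epsilon> > 0" "L-lipschitz_on (cball (k x) \<epsilon>) h"
    using assms(1) by (auto simp: lipschitz_near_def)
  obtain \<epsilon>' L' where k: "\<epsilon>' > 0" "L'-lipschitz_on (cball x \<epsilon>') k"
    using assms(2) by (auto simp: lipschitz_near_def)
  have L': "L' \<ge> 0" using k(2) by (rule lipschitz_on_nonneg)
  define \<rho> where "\<rho> = min \<epsilon>' (\<epsilon> / (L' + 1))"
  have \<rho>: "\<rho> > 0" using h k L' by (simp add: \<rho>_def)
  have k': "L'-lipschitz_on (cball x \<rho>) k"
    using k(2) by (rule lipschitz_on_subset) (auto simp: \<rho>_def)
  have "k ` cball x \<rho> \<subseteq> cball (k x) \<epsilon>"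
  proof (clarsimp)
    fix z assume z: "dist x z \<le> \<rho>"
    have "dist (k x) (k z) \<le> L' * dist x z"
      using lipschitz_onD[OF k'] z \<rho> by simp
    also have "\<dots> \<le> (L' + 1) * (\<epsilon> / (L' + 1))"
      using z L' by (intro mult_mono) (auto simp: \<rho>_def)
    also have "\<dots> = \<epsilon>" using L' by simp
    finally show "dist (k x) (k z) \<le> \<epsilon>" .
  qed
  then have "L-lipschitz_on (k ` cball x \<rho>) h"
    using h(2) lipschitz_on_subset by blast
  from lipschitz_on_compose2[OF k' this] show ?thesis
    using \<rho> unfolding lipschitz_near_def by blast
qed

lemma lipschitz_near_add:
  fixes h k :: "'a::metric_space \<Rightarrow> 'b::real_normed_vector"
  assumes "lipschitz_near x h" "lipschitz_near x k"
  shows "lipschitz_near x (\<lambda>z. h z + k z)"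
proof -
  obtain \<epsilon> L where h: "\<epsilon> > 0" "L-lipschitz_on (cball x \<epsilon>) h"
    using assms(1) by (auto simp: lipschitz_near_def)
  obtain \<epsilon>' L' where k: "\<epsilon>' > 0" "L'-lipschitz_on (cball x \<epsilon>') k"
    using assms(2) by (auto simp: lipschitz_near_def)
  have "(L + L')-lipschitz_on (cball x (min \<epsilon> \<epsilon>')) (\<lambda>z. h z + k z)"
    by (intro lipschitz_on_add lipschitz_on_subset[OF h(2)] lipschitz_on_subset[OF k(2)]) auto
  then show ?thesis using h k unfolding lipschitz_near_def by (intro exI[of _ "min \<epsilon> \<epsilon>'"]) auto
qed

lemma lipschitz_near_sum:
  fixes h :: "'i \<Rightarrow> 'a::metric_space \<Rightarrow> 'b::real_normed_vector"
  assumes "finite I" "\<And>i. i \<in> I \<Longrightarrow> lipschitz_near x (h i)"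
  shows "lipschitz_near x (\<lambda>z. \<Sum>i\<in>I. h i z)"
  using assms
  by (induction I rule: finite_induct) (auto intro: lipschitz_near_const lipschitz_near_add)

lemma lipschitz_near_scaleR:
  fixes h :: "'a::metric_space \<Rightarrow> real" and k :: "'a \<Rightarrow> 'b::real_normed_vector"
  assumes "lipschitz_near x h" "lipschitz_near x k"
  shows "lipschitz_near x (\<lambda>z. h z *\<^sub>R k z)"
proof -
  obtain \<epsilon> L where h: "\<epsilon> > 0" "L-lipschitz_on (cball x \<epsilon>) h"
    using assms(1) by (auto simp: lipschitz_near_def)
  obtain \<epsilon>' L' where k: "\<epsilon>' > 0" "L'-lipschitz_on (cball x \<epsilon>') k"
    using assms(2) by (auto simp: lipschitz_near_def)
  define \<rho> where "\<rho> = min \<epsilon> \<epsilon>'"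
  have \<rho>: "\<rho> > 0" using h k by (simp add: \<rho>_def)
  have h': "L-lipschitz_on (cball x \<rho>) h" and k': "L'-lipschitz_on (cball x \<rho>) k"
    by (auto simp: \<rho>_def intro: lipschitz_on_subset[OF h(2)] lipschitz_on_subset[OF k(2)])
  have L: "L \<ge> 0" "L' \<ge> 0" using h k lipschitz_on_nonneg by blast+
  define H where "H = norm (h x) + L * \<rho>"
  define K where "K = norm (k x) + L' * \<rho>"
  have bound: "norm (q z) \<le> norm (q x) + C * \<rho>"
    if "C-lipschitz_on (cball x \<rho>) q" "z \<in> cball x \<rho>" for q :: "'a \<Rightarrow> 'c::real_normed_vector" and C z
  proof -
    have "norm (q z) \<le> norm (q x) + dist (q z) (q x)" by (simp add: dist_norm norm_triangle_sub)
    also have "dist (q z) (q x) \<le> C * dist z x" using that \<rho> by (intro lipschitz_onD[OF that(1)]) auto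
    also have "\<dots> \<le> C * \<rho>" using that lipschitz_on_nonneg[OF that(1)]
      by (intro mult_left_mono) (auto simp: dist_commute)
    finally show ?thesis by simp
  qed
  have "(H * L' + L * K)-lipschitz_on (cball x \<rho>) (\<lambda>z. h z *\<^sub>R k z)"
  proof (rule lipschitz_onI)
    fix z z' assume z: "z \<in> cball x \<rho>" "z' \<in> cball x \<rho>"
    have "h z *\<^sub>R k z - h z' *\<^sub>R k z' = h z *\<^sub>R (k z - k z') + (h z - h z') *\<^sub>R k z'"
      by (simp add: algebra_simps)
    then have "dist (h z *\<^sub>R k z) (h z' *\<^sub>R k z')
        \<le> norm (h z) * dist (k z) (k z') + dist (h z) (h z') * norm (k z')"
      by (metis dist_norm norm_scaleR norm_triangle_ineq real_norm_def)
    also have "\<dots> \<le> H * (L' * dist z z') + (L * dist z z') * K"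
      unfolding H_def K_def using L \<rho> z
      by (intro add_mono mult_mono bound[OF h'] bound[OF k'] lipschitz_onD[OF h'] lipschitz_onD[OF k']) auto
    finally show "dist (h z *\<^sub>R k z) (h z' *\<^sub>R k z') \<le> (H * L' + L * K) * dist z z'"
      by (simp add: algebra_simps)
  qed (use L \<rho> in \<open>auto simp: H_def K_def\<close>)
  then show ?thesis using \<rho> unfolding lipschitz_near_def by blast
qed

text \<open>
  On a small compact ball the partial derivatives are bounded, hence so is the operator norm of the
  derivative, and the mean value inequality applies.
\<close>
lemma C1_lipschitz_near:
  fixes h :: "'a::euclidean_space \<Rightarrow> 'b::real_normed_vector"
  assumes C1: "Ck_on (Suc 0) S h" and S: "open S" "x \<in> S"
  shows "lipschitz_near x h"
proof -
  obtain \<epsilon> where \<epsilon>: "\<epsilon> > 0" "cball x \<epsilon> \<subseteq> S" using S open_contains_cball by blast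
  let ?D = "\<lambda>z. frechet_derivative h (at z)"
  have D: "(h has_derivative ?D z) (at z)" if "z \<in> cball x \<epsilon>" for z
  proof -
    have "h differentiable (at z)" using C1 \<epsilon>(2) that by auto
    then show ?thesis by (simp add: frechet_derivative_works)
  qed
  have "\<exists>B. \<forall>z\<in>cball x \<epsilon>. norm (?D z v) \<le> B" for v
  proof -
    have "continuous_on (cball x \<epsilon>) (\<lambda>z. ?D z v)"
      using C1 \<epsilon> by (auto intro: continuous_on_subset)
    then have "bounded ((\<lambda>z. ?D z v) ` cball x \<epsilon>)"
      by (intro compact_imp_bounded compact_continuous_image) auto
    then show ?thesis by (auto simp: bounded_iff)
  qed
  then obtain B where B: "\<And>v z. z \<in> cball x \<epsilon> \<Longrightarrow> norm (?D z v) \<le> B v" by metis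
  define L where "L = (\<Sum>i\<in>Basis. B i)"
  have on: "onorm (?D z) \<le> L" if z: "z \<in> cball x \<epsilon>" for z
  proof -
    have "onorm (?D z) \<le> (\<Sum>i\<in>Basis. norm (?D z i))"
      using D[OF z] has_derivative_bounded_linear by (intro onorm_componentwise) blast
    also have "\<dots> \<le> L" unfolding L_def using B[OF z] by (intro sum_mono)
    finally show ?thesis .
  qed
  have "L \<ge> 0" using on[of x] onorm_pos_le[of "?D x"] D[of x] \<epsilon>
    by (meson centre_in_cball has_derivative_bounded_linear less_eq_real_def order_trans)
  moreover have "dist (h z) (h z') \<le> L * dist z z'" if "z \<in> cball x \<epsilon>" "z' \<in> cball x \<epsilon>" for z z'
    unfolding dist_norm using on D that
    by (intro differentiable_bound[where S="cball x \<epsilon>" and f'="?D"])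
      (auto intro: has_derivative_at_withinI)
  ultimately have "L-lipschitz_on (cball x \<epsilon>) h" by (intro lipschitz_onI)
  then show ?thesis using \<epsilon> unfolding lipschitz_near_def by blast
qed

section \<open>The augmented vector field and its trajectories\<close>

lemma upper_joinv [simp]: "upper (joinv x y) = x"
  and lower_joinv [simp]: "lower (joinv x y) = y"
  and joinv_upper_lower [simp]: "joinv (upper \<xi>) (lower \<xi>) = \<xi>"
  by (auto simp: upper_def lower_def joinv_def Finite_Cartesian_Product.vec_eq_iff split: sum.split)

lemma mem_joint_set: "\<xi> \<in> joint_set A B \<longleftrightarrow> upper \<xi> \<in> A \<and> lower \<xi> \<in> B"
  unfolding joint_set_def by (auto intro!: exI[of _ "upper \<xi>"] exI[of _ "lower \<xi>"])

lemma bounded_linear_upper: "bounded_linear upper"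
  and bounded_linear_lower: "bounded_linear lower"
  and bounded_linear_joinv_left: "bounded_linear (\<lambda>x. joinv x 0)"
  and bounded_linear_joinv_right: "bounded_linear (\<lambda>y. joinv 0 y)"
  unfolding linear_conv_bounded_linear[symmetric]
  by (auto intro!: linearI simp: upper_def lower_def joinv_def Finite_Cartesian_Product.vec_eq_iff split: sum.split)

lemma joinv_split: "joinv x y = joinv x 0 + joinv 0 y"
  by (auto simp: joinv_def Finite_Cartesian_Product.vec_eq_iff split: sum.split)

lemma joinv_add: "joinv x y + joinv x' y' = joinv (x + x') (y + y')"
  by (auto simp: joinv_def Finite_Cartesian_Product.vec_eq_iff split: sum.split)

lemma open_joint_set:
  assumes "open A" "open B"
  shows "open (joint_set A B)"
proof -
  have "joint_set A B = (upper -` A) \<inter> (lower -` B)" by (auto simp: mem_joint_set)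
  then show ?thesis
    using assms bounded_linear_upper bounded_linear_lower
    by (auto intro!: open_Int open_vimage linear_continuous_on)
qed

lemma block_diag_mult: "block_diag A B *v U = joinv (A *v upper U) (B *v lower U)"
proof -
  have "(block_diag A B *v U) $ i = joinv (A *v upper U) (B *v lower U) $ i" for i
  proof (cases i)
    case (Inl i')
    have "(block_diag A B *v U) $ i = (\<Sum>s\<in>UNIV <+> UNIV. block_diag A B $ i $ s * U $ s)"
      by (simp add: matrix_vector_mult_def)
    also have "\<dots> = (A *v upper U) $ i'"
      by (subst sum.Plus) (auto simp: Inl block_diag_def matrix_vector_mult_def upper_def)
    finally show ?thesis by (simp add: joinv_def Inl)
  next
    case (Inr i')
    have "(block_diag A B *v U) $ i = (\<Sum>s\<in>UNIV <+> UNIV. block_diag A B $ i $ s * U $ s)"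
      by (simp add: matrix_vector_mult_def)
    also have "\<dots> = (B *v lower U) $ i'"
      by (subst sum.Plus) (auto simp: Inr block_diag_def matrix_vector_mult_def lower_def)
    finally show ?thesis by (simp add: joinv_def Inr)
  qed
  then show ?thesis by (simp add: Finite_Cartesian_Product.vec_eq_iff)
qed

lemma upper_zero [simp]: "upper 0 = 0" and lower_zero [simp]: "lower 0 = 0"
  by (simp_all add: upper_def lower_def Finite_Cartesian_Product.vec_eq_iff)

lemma joinv_zero [simp]: "joinv 0 0 = 0"
  by (simp add: joinv_def Finite_Cartesian_Product.vec_eq_iff split: sum.split)

lemma block_diag_zero [simp]: "block_diag 0 0 = 0"
  by (simp add: block_diag_def Finite_Cartesian_Product.vec_eq_iff split: sum.split)

lemma tuple_transpose_times_zero [simp]: "tuple_transpose_times 0 y = 0"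
  by (simp add: tuple_transpose_times_def Finite_Cartesian_Product.vec_eq_iff
      Finite_Cartesian_Product.transpose_def matrix_vector_mult_def)

lemma transpose_zero [simp]: "Finite_Cartesian_Product.transpose 0 = 0"
  by (simp add: Finite_Cartesian_Product.vec_eq_iff Finite_Cartesian_Product.transpose_def)

lemma jacobian_mult:
  fixes h :: "real^'a \<Rightarrow> real^'b"
  assumes "h differentiable (at x)"
  shows "jacobian h (at x) *v y = frechet_derivative h (at x) y"
  using frechet_derivative_at[OF assms[unfolded jacobian_works]] by (rule fun_cong)

text \<open>
  The Jacobians of the columns assemble to the derivative of \<open>g\<close> itself, so that \<open>g\<close> enters the
  augmented field in the same way as \<open>f\<close>.
\<close>
lemma grad_times_eq_frechet_derivative:
  assumes "g differentiable (at x)"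
  shows "grad_times g x y = frechet_derivative g (at x) y"
proof -
  have "jacobian (\<lambda>z. column j (g z)) (at x) *v y = column j (frechet_derivative g (at x) y)" for j
  proof -
    have "linear (column j :: real^'b^'a \<Rightarrow> real^'a)"
      by (auto intro!: linearI simp: column_def Finite_Cartesian_Product.vec_eq_iff)
    then have bl: "bounded_linear (column j :: real^'b^'a \<Rightarrow> real^'a)"
      by (simp add: linear_conv_bounded_linear)
    have "((\<lambda>z. column j (g z)) has_derivative (\<lambda>y. column j (frechet_derivative g (at x) y))) (at x)"
      using assms by (intro bounded_linear.has_derivative[OF bl]) (simp add: frechet_derivative_works)
    then show ?thesis
      by (metis differentiableI frechet_derivative_at jacobian_mult)
  qed
  then show ?thesis by (simp add: grad_times_def column_def Finite_Cartesian_Product.vec_eq_iff)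
qed

text \<open>
  The lower block of the augmented field is \<open>D f(x) y + (D g(x) y) v\<close>. Written in coordinates the
  derivatives become sums of products \<open>y\<^sub>i D h(x) e\<^sub>i\<close>, whose factors are Lipschitz near every point.
\<close>
lemma linear_in_coordinates:
  fixes A :: "real^'n \<Rightarrow> 'b::real_vector"
  assumes "linear A"
  shows "A y = (\<Sum>i\<in>UNIV. y $ i *\<^sub>R A (axis i 1))"
proof -
  have "A y = A (\<Sum>i\<in>UNIV. y $ i *\<^sub>R axis i 1)"
    using basis_expansion[of y] by (simp add: scalar_mult_eq_scaleR)
  then show ?thesis by (simp add: linear_sum[OF assms] linear_scale[OF assms])
qed

lemma Ck_on_2_differentiable: "Ck_on 2 S h \<Longrightarrow> x \<in> S \<Longrightarrow> h differentiable (at x)"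
  and Ck_on_2_derivative: "Ck_on 2 S h \<Longrightarrow> Ck_on (Suc 0) S (\<lambda>x. frechet_derivative h (at x) v)"
  by (simp_all add: numeral_2_eq_2)

text \<open>
  \<open>Ck_on 2\<close> asks for differentiable directional derivatives; their continuity is a consequence.
\<close>
lemma Ck_on_2_imp_C1:
  assumes "Ck_on 2 S h"
  shows "Ck_on (Suc 0) S h"
proof -
  have "continuous_on S (\<lambda>x. frechet_derivative h (at x) v)" for v
  proof (rule differentiable_imp_continuous_on)
    have "(\<lambda>x. frechet_derivative h (at x) v) differentiable (at x)" if "x \<in> S" for x
      using assms that by (simp add: numeral_2_eq_2)
    then show "(\<lambda>x. frechet_derivative h (at x) v) differentiable_on S"
      by (simp add: differentiable_on_def differentiable_at_withinI)
  qed
  then show ?thesis using assms by (simp add: numeral_2_eq_2)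
qed

lemma aug_field_eq:
  assumes "f differentiable (at (upper \<xi>))" "g differentiable (at (upper \<xi>))"
  shows "aug_F f \<xi> + aug_G g \<xi> *v U =
    joinv (f (upper \<xi>) + g (upper \<xi>) *v upper U)
      (frechet_derivative f (at (upper \<xi>)) (lower \<xi>)
        + frechet_derivative g (at (upper \<xi>)) (lower \<xi>) *v lower U)"
  unfolding aug_F_def aug_G_def block_diag_mult jacobian_mult[OF assms(1)]
    grad_times_eq_frechet_derivative[OF assms(2)] joinv_add ..

lemma lipschitz_near_postcompose:
  assumes "bounded_linear A" "lipschitz_near x h"
  shows "lipschitz_near x (\<lambda>z. A (h z))"
  by (rule lipschitz_near_compose[OF lipschitz_near_bounded_linear[OF assms(1)] assms(2)])

lemma lipschitz_near_precompose:
  assumes "bounded_linear A" "lipschitz_near (A x) h"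
  shows "lipschitz_near x (\<lambda>z. h (A z))"
  by (rule lipschitz_near_compose[OF assms(2) lipschitz_near_bounded_linear[OF assms(1)]])

lemma lipschitz_near_derivative_applied:
  fixes h :: "real^'n \<Rightarrow> 'b::real_normed_vector"
  assumes h: "Ck_on 2 \<Omega> h" and \<Omega>: "open \<Omega>" and \<xi>: "\<xi> \<in> joint_set \<Omega> UNIV"
  shows "lipschitz_near \<xi> (\<lambda>\<zeta>. \<Sum>i\<in>UNIV. lower \<zeta> $ i *\<^sub>R frechet_derivative h (at (upper \<zeta>)) (axis i 1))"
proof (intro lipschitz_near_sum lipschitz_near_scaleR)
  show "lipschitz_near \<xi> (\<lambda>\<zeta>. lower \<zeta> $ i)" for i
    using bounded_linear_compose[OF bounded_linear_vec_nth bounded_linear_lower]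
    by (rule lipschitz_near_bounded_linear)
  show "lipschitz_near \<xi> (\<lambda>\<zeta>. frechet_derivative h (at (upper \<zeta>)) (axis i 1))" for i
    using \<xi> by (intro lipschitz_near_precompose[OF bounded_linear_upper]
        C1_lipschitz_near[OF Ck_on_2_derivative[OF h] \<Omega>]) (simp add: mem_joint_set)
qed simp

lemma aug_trajectory_exists:
  fixes f :: "real^'n \<Rightarrow> real^'n" and g :: "real^'n \<Rightarrow> real^'m^'n"
  assumes \<Omega>: "open \<Omega>" and f: "Ck_on 2 \<Omega> f" and g: "Ck_on 2 \<Omega> g" and \<xi>: "\<xi> \<in> joint_set \<Omega> UNIV"
  obtains \<tau> z where "\<tau> > 0" "aug_trajectory \<Omega> f g U \<xi> \<tau> z"
proof -
  define \<Phi> where "\<Phi> = (\<lambda>\<zeta>. joinv (f (upper \<zeta>) + g (upper \<zeta>) *v upper U) 0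
     + joinv 0 ((\<Sum>i\<in>UNIV. lower \<zeta> $ i *\<^sub>R frechet_derivative f (at (upper \<zeta>)) (axis i 1))
        + (\<Sum>i\<in>UNIV. lower \<zeta> $ i *\<^sub>R frechet_derivative g (at (upper \<zeta>)) (axis i 1)) *v lower U))"
  have mult: "bounded_linear (\<lambda>A :: real^'m^'n. A *v u)" for u
    unfolding linear_conv_bounded_linear[symmetric]
    by (auto intro!: linearI simp: matrix_vector_mult_add_rdistrib scaleR_matrix_vector_assoc)
  have at_upper: "lipschitz_near \<xi> (\<lambda>\<zeta>. h (upper \<zeta>))" if "Ck_on 2 \<Omega> h"
    for h :: "real^'n \<Rightarrow> 'c::real_normed_vector"
    using \<xi> by (intro lipschitz_near_precompose[OF bounded_linear_upper]
        C1_lipschitz_near[OF Ck_on_2_imp_C1[OF that] \<Omega>]) (simp add: mem_joint_set)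
  have lip: "lipschitz_near \<xi> \<Phi>"
    unfolding \<Phi>_def
    by (intro lipschitz_near_add lipschitz_near_postcompose[OF bounded_linear_joinv_left]
        lipschitz_near_postcompose[OF bounded_linear_joinv_right]
        lipschitz_near_postcompose[OF mult] at_upper f g
        lipschitz_near_derivative_applied[OF _ \<Omega> \<xi>])
  have eq: "aug_F f \<zeta> + aug_G g \<zeta> *v U = \<Phi> \<zeta>" if "\<zeta> \<in> joint_set \<Omega> UNIV" for \<zeta>
  proof -
    have d: "f differentiable (at (upper \<zeta>))" "g differentiable (at (upper \<zeta>))"
      using that f g Ck_on_2_differentiable by (auto simp: mem_joint_set)
    show ?thesis
      unfolding aug_field_eq[OF d] \<Phi>_def joinv_split[symmetric]
      using linear_in_coordinates[OF linear_frechet_derivative[OF d(1)], of "lower \<zeta>"]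
        linear_in_coordinates[OF linear_frechet_derivative[OF d(2)], of "lower \<zeta>"] by simp
  qed
  obtain \<epsilon> L where \<epsilon>: "\<epsilon> > 0" "cball \<xi> \<epsilon> \<subseteq> joint_set \<Omega> UNIV"
    and L: "L-lipschitz_on (cball \<xi> \<epsilon>) (\<lambda>\<zeta>. aug_F f \<zeta> + aug_G g \<zeta> *v U)"
    using lipschitz_near_on_open[OF lip open_joint_set[OF \<Omega> open_UNIV] \<xi> eq] by blast
  obtain \<tau> z where "\<tau> > 0" "z 0 = \<xi>" "\<And>s. s \<in> {0..\<tau>} \<Longrightarrow> z s \<in> cball \<xi> \<epsilon> \<and>
      (z has_vector_derivative (aug_F f (z s) + aug_G g (z s) *v U)) (at s within {0..\<tau>})"
    using local_solution_of_lipschitz_ode[OF \<epsilon>(1) L] by blast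
  then show thesis using that[of \<tau> z] \<epsilon>(2) unfolding aug_trajectory_def by blast
qed

lemma aug_trajectory_shorter:
  assumes "aug_trajectory \<Omega> f g U \<xi> \<tau> z" "t \<le> \<tau>"
  shows "aug_trajectory \<Omega> f g U \<xi> t z"
  using assms unfolding aug_trajectory_def
  by (auto intro: has_vector_derivative_within_subset[of _ _ _ "{0..\<tau>}"])

section \<open>The Lie operator as a matrix on an invariant dictionary\<close>

text \<open>
  The deterministic part of the hypotheses: the system, and a dictionary that contains the
  coordinates and is differentiable and independent over \<open>\<Omega>\<close>.
\<close>
locale augmented_dictionary =
  fixes \<Omega> :: "(real^'n) set" and f :: "real^'n \<Rightarrow> real^'n" and g :: "real^'n \<Rightarrow> real^'m^'n"
    and N K :: nat and \<phi> :: "nat \<Rightarrow> real^'n \<Rightarrow> real" and a :: "nat \<Rightarrow> real^'n \<Rightarrow> real^'n"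
  assumes open_\<Omega>: "open \<Omega>" and zero_in_\<Omega>: "0 \<in> \<Omega>"
    and C2_f: "Ck_on 2 \<Omega> f" and f_0: "f 0 = 0" and C2_g: "Ck_on 2 \<Omega> g"
    and dims: "CARD('n) \<le> N" "CARD('n) \<le> K"
    and \<phi>_coord: "\<And>i x. x \<in> \<Omega> \<Longrightarrow> \<phi> (coord_pos i) x = x $ i"
    and a_coord: "\<And>i x. x \<in> \<Omega> \<Longrightarrow> a (coord_pos i) x = axis i 1"
    and \<phi>_diff: "\<And>k x. k < N \<Longrightarrow> x \<in> \<Omega> \<Longrightarrow> \<phi> k differentiable (at x)"
    and \<phi>_0: "\<And>k. k < N \<Longrightarrow> \<phi> k 0 = 0"
    and a_diff: "\<And>k x. k < K \<Longrightarrow> x \<in> \<Omega> \<Longrightarrow> a k differentiable (at x)"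
    and independent: "dict_independent \<Omega> N K \<phi> a"
begin

abbreviation \<Xi> :: "(real^('n + 'n)) set" where "\<Xi> \<equiv> joint_set \<Omega> UNIV"

abbreviation p :: nat where "p \<equiv> dict_size N K"

abbreviation \<psi> :: "nat \<Rightarrow> real^('n + 'n) \<Rightarrow> real" where "\<psi> \<equiv> dict N \<phi> a"

abbreviation \<L> :: "real^('m + 'm) \<Rightarrow> (real^('n + 'n) \<Rightarrow> real) \<Rightarrow> real^('n + 'n) \<Rightarrow> real" where
  "\<L> \<equiv> lie_op f g"

lemma independent_on_\<Xi>: "independent_on \<Xi> p \<psi>"
  using independent unfolding dict_independent_def independent_on_def by blast

lemma dict_differentiable:
  assumes l: "l < p" and \<xi>: "\<xi> \<in> \<Xi>"
  shows "\<psi> l differentiable (at \<xi>)"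
proof -
  have up: "upper \<xi> \<in> \<Omega>" using \<xi> by (simp add: mem_joint_set)
  have dup: "upper differentiable (at \<xi>)" "lower differentiable (at \<xi>)"
    using bounded_linear_upper bounded_linear_lower bounded_linear_imp_differentiable by blast+
  consider "l = 0" | "l \<noteq> 0" "l \<le> N" | "N < l" by linarith
  then show ?thesis
  proof cases
    case 1
    then show ?thesis by (simp add: dict_def[abs_def])
  next
    case 2
    then have "(\<lambda>\<zeta>. \<phi> (l - 1) (upper \<zeta>)) differentiable (at \<xi>)"
      using up by (intro differentiable_compose[of "\<phi> (l - 1)" upper] dup(1) \<phi>_diff) auto
    then show ?thesis using 2 by (simp add: dict_def[abs_def])
  next
    case 3
    have "(\<lambda>\<zeta>. a (l - 1 - N) (upper \<zeta>)) differentiable (at \<xi>)"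
      using up l 3 by (intro differentiable_compose[of "a (l - 1 - N)" upper] dup(1) a_diff) auto
    from this[unfolded frechet_derivative_works] dup(2)[unfolded frechet_derivative_works]
    have "(\<lambda>\<zeta>. inner (a (l - 1 - N) (upper \<zeta>)) (lower \<zeta>)) differentiable (at \<xi>)"
      by (rule differentiableI[OF has_derivative_inner])
    then show ?thesis using 3 by (simp add: dict_def[abs_def])
  qed
qed

text \<open>
  The difference quotients \<open>(\<psi>\<^sub>l(\<xi>(t)) - \<psi>\<^sub>l(\<xi>)) / t\<close> are values of functions \<open>q t\<close> in the span
  of the dictionary. They converge pointwise to \<open>\<L> U (\<psi> l)\<close> as \<open>t\<close> tends to \<open>0\<close>, even
  though the time for which a trajectory exists is not uniform in \<open>\<xi>\<close>.
\<close>
lemma lie_op_dict_along_admissible_control: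
  assumes inv: "dict_invariant \<Omega> f g \<U> N K \<phi> a" and U: "U \<in> \<U>" and l: "l < p"
  shows "\<exists>c. \<forall>\<xi>\<in>\<Xi>. \<L> U (\<psi> l) \<xi> = (\<Sum>k<p. c k * \<psi> k \<xi>)"
proof -
  have "\<psi> l = (\<lambda>\<xi>. \<Sum>k<p. (if k = l then 1 else 0) * \<psi> k \<xi>)"
    unfolding sum_unit_coefficient[OF l] ..
  then have "\<psi> l \<in> dict_space N K \<phi> a"
    unfolding dict_space_def mem_Collect_eq
    by (intro exI[of _ "\<lambda>k. if k = l then 1 else 0"] conjI TrueI)
  then have "\<forall>t\<ge>0. \<exists>h'\<in>dict_space N K \<phi> a. \<forall>\<xi> z. aug_trajectory \<Omega> f g U \<xi> t z \<longrightarrow> \<psi> l (z t) = h' \<xi>"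
    using inv U unfolding dict_invariant_def by blast
  then have "\<forall>t. \<exists>c. t \<ge> 0 \<longrightarrow> (\<forall>\<xi> z. aug_trajectory \<Omega> f g U \<xi> t z \<longrightarrow> \<psi> l (z t) = (\<Sum>k<p. c k * \<psi> k \<xi>))"
    unfolding dict_space_def by blast
  from choice[OF this] obtain c where c: "\<And>t \<xi> z. t \<ge> 0 \<Longrightarrow> aug_trajectory \<Omega> f g U \<xi> t z \<Longrightarrow>
      \<psi> l (z t) = (\<Sum>k<p. c t k * \<psi> k \<xi>)"
    by blast
  define c' where "c' t k = (c t k - (if k = l then 1 else 0)) / t" for t k
  define q where "q t \<xi> = (\<Sum>k<p. c' t k * \<psi> k \<xi>)" for t \<xi>
  have q_eq: "q t \<xi> = ((\<Sum>k<p. c t k * \<psi> k \<xi>) - \<psi> l \<xi>) / t" for t \<xi>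
  proof -
    have "q t \<xi> = (\<Sum>k<p. (c t k * \<psi> k \<xi> - (if k = l then 1 else 0) * \<psi> k \<xi>) / t)"
      unfolding q_def c'_def by (intro sum.cong) (auto simp: left_diff_distrib diff_divide_distrib)
    also have "\<dots> = ((\<Sum>k<p. c t k * \<psi> k \<xi>) - (\<Sum>k<p. (if k = l then 1 else 0) * \<psi> k \<xi>)) / t"
      by (simp add: sum_divide_distrib[symmetric] sum_subtractf)
    finally show ?thesis unfolding sum_unit_coefficient[OF l] .
  qed
  show ?thesis
  proof (rule span_closed_under_pointwise_limits[OF independent_on_\<Xi>])
    show "at_right (0::real) \<noteq> bot" by simp
    show "eventually (\<lambda>t. q t \<xi> = (\<Sum>k<p. c' t k * \<psi> k \<xi>)) (at_right 0)" for \<xi>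
      by (simp add: q_def)
    fix \<xi> assume \<xi>: "\<xi> \<in> \<Xi>"
    obtain \<tau> z where \<tau>: "\<tau> > 0" and z: "aug_trajectory \<Omega> f g U \<xi> \<tau> z"
      using aug_trajectory_exists[OF open_\<Omega> C2_f C2_g \<xi>] by blast
    have z0: "z 0 = \<xi>" using z by (simp add: aug_trajectory_def)
    have dz: "(z has_vector_derivative (aug_F f \<xi> + aug_G g \<xi> *v U)) (at 0 within {0..\<tau>})"
      using z \<tau> unfolding aug_trajectory_def by force
    have "(\<psi> l has_derivative frechet_derivative (\<psi> l) (at \<xi>)) (at (z 0))"
      using dict_differentiable[OF l \<xi>] by (simp add: z0 frechet_derivative_works)
    then have "(\<psi> l has_derivative frechet_derivative (\<psi> l) (at \<xi>)) (at (z 0) within z ` {0..\<tau>})"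
      by (rule has_derivative_at_withinI)
    from vector_derivative_diff_chain_within[OF dz this]
    have "((\<psi> l \<circ> z) has_vector_derivative \<L> U (\<psi> l) \<xi>) (at 0 within {0..\<tau>})"
      by (simp add: lie_op_def)
    then have "((\<lambda>t. (\<psi> l (z t) - \<psi> l \<xi>) / t) \<longlongrightarrow> \<L> U (\<psi> l) \<xi>) (at_right 0)"
      using at_within_Icc_at_right[OF \<tau>]
      by (simp add: has_real_derivative_iff_has_vector_derivative[symmetric] has_field_derivative_iff z0)
    moreover have "eventually (\<lambda>t. (\<psi> l (z t) - \<psi> l \<xi>) / t = q t \<xi>) (at_right 0)"
      using eventually_at_right_less[of 0] eventually_at_right_real[OF \<tau>]
    proof eventually_elim
      case (elim t)
      then have "\<psi> l (z t) = (\<Sum>k<p. c t k * \<psi> k \<xi>)"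
        by (intro c aug_trajectory_shorter[OF z]) auto
      then show ?case by (simp add: q_eq)
    qed
    ultimately show "((\<lambda>t. q t \<xi>) \<longlongrightarrow> \<L> U (\<psi> l) \<xi>) (at_right 0)"
      by (rule Lim_transform_eventually)
  qed
qed

lemma lie_op_affine:
  assumes "l < p" "\<xi> \<in> \<Xi>"
  shows "\<L> (U0 + s *\<^sub>R (U - U0)) (\<psi> l) \<xi> = \<L> U0 (\<psi> l) \<xi> + s * (\<L> U (\<psi> l) \<xi> - \<L> U0 (\<psi> l) \<xi>)"
proof -
  have lin: "linear (frechet_derivative (\<psi> l) (at \<xi>))"
    using dict_differentiable[OF assms] by (rule linear_frechet_derivative)
  have eq: "aug_F f \<xi> + aug_G g \<xi> *v (U0 + s *\<^sub>R (U - U0)) =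
      (aug_F f \<xi> + aug_G g \<xi> *v U0)
      + s *\<^sub>R ((aug_F f \<xi> + aug_G g \<xi> *v U) - (aug_F f \<xi> + aug_G g \<xi> *v U0))"
    by (simp add: matrix_vector_right_distrib matrix_vector_mult_scaleR matrix_vector_mult_diff_distrib)
  show ?thesis
    unfolding lie_op_def eq linear_add[OF lin] linear_scale[OF lin] linear_diff[OF lin] real_scaleR_def ..
qed

definition represents_lie_op :: "(nat \<Rightarrow> nat \<Rightarrow> real) \<Rightarrow> real^('m + 'm) \<Rightarrow> bool" where
  "represents_lie_op C U \<longleftrightarrow>
     (\<forall>l<p. \<forall>\<xi>\<in>\<Xi>. \<L> U (\<psi> l) \<xi> = (\<Sum>k<p. C l k * \<psi> k \<xi>))"

text \<open>
  An arbitrary \<open>U\<close> need not be admissible, but some point \<open>U0 + s (U - U0)\<close> with \<open>s > 0\<close> next to an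
  admissible \<open>U0\<close> is, and \<open>\<L> U\<close> is an affine combination of the operators at these two controls.
\<close>
lemma lie_op_dict_in_span:
  assumes inv: "dict_invariant \<Omega> f g \<U> N K \<phi> a" and \<U>: "open \<U>" "\<U> \<noteq> {}"
  shows "\<exists>C. represents_lie_op C U"
proof -
  obtain U0 where U0: "U0 \<in> \<U>" using \<U> by blast
  have "((\<lambda>s. U0 + s *\<^sub>R (U - U0)) \<longlongrightarrow> U0 + 0 *\<^sub>R (U - U0)) (at_right 0)"
    by (intro tendsto_intros)
  then have "eventually (\<lambda>s. U0 + s *\<^sub>R (U - U0) \<in> \<U>) (at_right 0)"
    using \<U> U0 by (intro topological_tendstoD[where f="\<lambda>s. U0 + s *\<^sub>R (U - U0)"]) auto
  then have "eventually (\<lambda>s. 0 < s \<and> U0 + s *\<^sub>R (U - U0) \<in> \<U>) (at_right (0::real))"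
    using eventually_at_right_less[of "0::real"] by eventually_elim auto
  then obtain s :: real where s: "s > 0" "U0 + s *\<^sub>R (U - U0) \<in> \<U>"
    using eventually_happens[of _ "at_right (0::real)"] by auto
  have "\<exists>c. \<forall>\<xi>\<in>\<Xi>. \<L> U (\<psi> l) \<xi> = (\<Sum>k<p. c k * \<psi> k \<xi>)" if l: "l < p" for l
  proof -
    obtain c0 where c0: "\<And>\<xi>. \<xi> \<in> \<Xi> \<Longrightarrow> \<L> U0 (\<psi> l) \<xi> = (\<Sum>k<p. c0 k * \<psi> k \<xi>)"
      using lie_op_dict_along_admissible_control[OF inv U0 l] by blast
    obtain c1 where c1: "\<And>\<xi>. \<xi> \<in> \<Xi> \<Longrightarrow>
        \<L> (U0 + s *\<^sub>R (U - U0)) (\<psi> l) \<xi> = (\<Sum>k<p. c1 k * \<psi> k \<xi>)"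
      using lie_op_dict_along_admissible_control[OF inv s(2) l] by blast
    have "\<L> U (\<psi> l) \<xi> = (\<Sum>k<p. (c0 k + (c1 k - c0 k) / s) * \<psi> k \<xi>)" if \<xi>: "\<xi> \<in> \<Xi>" for \<xi>
    proof -
      have "\<L> U (\<psi> l) \<xi> = (\<Sum>k<p. c0 k * \<psi> k \<xi>) + ((\<Sum>k<p. c1 k * \<psi> k \<xi>) - (\<Sum>k<p. c0 k * \<psi> k \<xi>)) / s"
        using lie_op_affine[OF l \<xi>, of U0 s U] s(1) c0[OF \<xi>] c1[OF \<xi>] by (simp add: field_simps)
      also have "\<dots> = (\<Sum>k<p. c0 k * \<psi> k \<xi> + (c1 k * \<psi> k \<xi> - c0 k * \<psi> k \<xi>) / s)"
        by (simp only: sum.distrib sum_divide_distrib[symmetric] sum_subtractf)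
      also have "\<dots> = (\<Sum>k<p. (c0 k + (c1 k - c0 k) / s) * \<psi> k \<xi>)"
        by (intro sum.cong) (auto simp: algebra_simps diff_divide_distrib)
      finally show ?thesis .
    qed
    then show ?thesis by (intro exI[of _ "\<lambda>k. c0 k + (c1 k - c0 k) / s"] ballI)
  qed
  then have "\<forall>l. \<exists>c. l < p \<longrightarrow> (\<forall>\<xi>\<in>\<Xi>. \<L> U (\<psi> l) \<xi> = (\<Sum>k<p. c k * \<psi> k \<xi>))" by blast
  from choice[OF this] obtain C where
    "\<forall>l. l < p \<longrightarrow> (\<forall>\<xi>\<in>\<Xi>. \<L> U (\<psi> l) \<xi> = (\<Sum>k<p. C l k * \<psi> k \<xi>))" ..
  then have "represents_lie_op C U" unfolding represents_lie_op_def .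
  then show ?thesis by (rule exI[of _ C])
qed

end

section \<open>Least squares with a data matrix of full row rank\<close>

text \<open>
  A right inverse is a dual basis of the rows, seen as functions of the column index.
\<close>
lemma full_row_rank_right_inverse:
  assumes A: "A \<in> carrier_mat n d" and ind: "independent_on {..<d} n (\<lambda>l j. A $$ (l, j))"
  obtains R where "R \<in> carrier_mat d n" "A * R = 1\<^sub>m n"
proof -
  obtain T B where T: "finite T" "T \<subseteq> {..<d}"
    and B: "\<And>l k. l < n \<Longrightarrow> k < n \<Longrightarrow> (\<Sum>j\<in>T. B l j * A $$ (k, j)) = (if l = k then 1 else 0)"
    using point_evaluation_dual_basis[OF ind] by blast
  define R where "R = Matrix.mat d n (\<lambda>(j, l). if j \<in> T then B l j else 0)"
  have R: "R \<in> carrier_mat d n" by (simp add: R_def)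
  have "A * R = 1\<^sub>m n"
  proof (rule eq_matI)
    fix k l assume "k < dim_row (1\<^sub>m n :: real mat)" "l < dim_col (1\<^sub>m n :: real mat)"
    then have kl: "k < n" "l < n" by auto
    have "(A * R) $$ (k, l) = (\<Sum>j<d. A $$ (k, j) * (if j \<in> T then B l j else 0))"
      using A R kl by (simp add: scalar_prod_def R_def atLeast0LessThan)
    also have "\<dots> = (\<Sum>j\<in>T. B l j * A $$ (k, j))"
      using T by (intro sum.mono_neutral_cong_right) auto
    finally show "(A * R) $$ (k, l) = 1\<^sub>m n $$ (k, l)" using kl B by simp
  qed (use A R in auto)
  with R show thesis by (rule that)
qed

text \<open>
  For full row rank, \<open>A\<^sup>T (A A\<^sup>T)\<^sup>-\<^sup>1\<close> satisfies the Penrose equations, as the Gram matrix inherits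
  independent rows from \<open>A\<close>. The Penrose equations determine the pseudo-inverse, and so it is this
  right inverse of \<open>A\<close>.
\<close>
lemma pseudo_inverse_full_row_rank:
  assumes A: "A \<in> carrier_mat n d" and ind: "independent_on {..<d} n (\<lambda>l j. A $$ (l, j))"
  shows "pseudo_inverse A \<in> carrier_mat d n" "A * pseudo_inverse A = 1\<^sub>m n"
proof -
  let ?At = "transpose_mat A"
  define Gm where "Gm = A * ?At"
  have At: "?At \<in> carrier_mat d n" and Gm: "Gm \<in> carrier_mat n n" using A by (auto simp: Gm_def)
  have Gm_entry: "Gm $$ (l, k) = (\<Sum>j<d. A $$ (l, j) * A $$ (k, j))" if "l < n" "k < n" for l k
    using that A by (simp add: Gm_def scalar_prod_def atLeast0LessThan)
  have "independent_on {..<n} n (\<lambda>l k. Gm $$ (l, k))"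
    unfolding independent_on_def
  proof (rule allI, rule impI)
    fix c assume c: "\<forall>k\<in>{..<n}. (\<Sum>l<n. c l * Gm $$ (l, k)) = 0"
    let ?v = "\<lambda>j. \<Sum>l<n. c l * A $$ (l, j)"
    have "(\<Sum>j<d. (?v j)\<^sup>2) = (\<Sum>j<d. \<Sum>k<n. \<Sum>l<n. c k * (c l * (A $$ (l, j) * A $$ (k, j))))"
      by (simp add: power2_eq_square sum_product algebra_simps)
    also have "\<dots> = (\<Sum>k<n. \<Sum>j<d. \<Sum>l<n. c k * (c l * (A $$ (l, j) * A $$ (k, j))))"
      by (rule sum.swap)
    also have "\<dots> = (\<Sum>k<n. \<Sum>l<n. \<Sum>j<d. c k * (c l * (A $$ (l, j) * A $$ (k, j))))"
      by (intro sum.cong refl sum.swap)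
    also have "\<dots> = (\<Sum>k<n. c k * (\<Sum>l<n. c l * Gm $$ (l, k)))"
      by (simp add: Gm_entry sum_distrib_left)
    also have "\<dots> = 0" using c by simp
    finally have "\<forall>j\<in>{..<d}. ?v j = 0"
      by (subst (asm) sum_nonneg_eq_0_iff) auto
    with ind show "\<forall>l<n. c l = 0" unfolding independent_on_def by blast
  qed
  then obtain H where H: "H \<in> carrier_mat n n" and GH: "Gm * H = 1\<^sub>m n"
    using full_row_rank_right_inverse[OF Gm] by blast
  have Ht: "transpose_mat H \<in> carrier_mat n n" using H by simp
  have Gm_sym: "transpose_mat Gm = Gm"
    using A At by (simp add: Gm_def transpose_mult[OF A At])
  have HtG: "transpose_mat H * Gm = 1\<^sub>m n"
    using arg_cong[OF GH, of transpose_mat] by (simp add: transpose_mult[OF Gm H] Gm_sym)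
  have H_sym: "transpose_mat H = H"
  proof -
    have "transpose_mat H = transpose_mat H * (Gm * H)" using Ht by (simp add: GH)
    also have "\<dots> = (transpose_mat H * Gm) * H" using assoc_mult_mat[OF Ht Gm H] by simp
    finally show ?thesis using H by (simp add: HtG)
  qed
  define P where "P = ?At * H"
  have P: "P \<in> carrier_mat d n" using At H by (simp add: P_def)
  have AP: "A * P = 1\<^sub>m n"
    unfolding P_def assoc_mult_mat[OF A At H, symmetric] using GH by (simp add: Gm_def)
  have HA: "H * A \<in> carrier_mat n d" using H A by simp
  have PA_eq: "P * A = ?At * (H * A)" unfolding P_def by (rule assoc_mult_mat[OF At H A])
  have PA_sym: "transpose_mat (P * A) = P * A"
    unfolding PA_eq transpose_mult[OF At HA] transpose_mult[OF H A] H_sym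
    using assoc_mult_mat[OF At H A] by simp
  have pinv: "is_pseudo_inverse A P"
    using A P AP PA_sym assoc_mult_mat[OF P A P] by (simp add: is_pseudo_inverse_def)
  have "Q = P" if Q: "is_pseudo_inverse A Q" for Q
  proof -
    have Qc: "Q \<in> carrier_mat d n" and AQA: "A * Q * A = A" and QAQ: "Q * A * Q = Q"
      and QA_sym: "transpose_mat (Q * A) = Q * A"
      using Q A by (auto simp: is_pseudo_inverse_def)
    have QA: "Q * A \<in> carrier_mat d d" and PA: "P * A \<in> carrier_mat d d" using A P Qc by auto
    have AQ: "A * Q = 1\<^sub>m n"
    proof -
      have AQc: "A * Q \<in> carrier_mat n n" using A Qc by simp
      have "A * Q = A * Q * (A * P)" unfolding AP right_mult_one_mat[OF AQc] ..
      also have "\<dots> = A * Q * A * P" using assoc_mult_mat[OF AQc A P] by simp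
      finally show ?thesis by (simp add: AQA AP)
    qed
    have AQA': "A * (Q * A) = A" using assoc_mult_mat[OF A Qc A] AQA by simp
    have APA': "A * (P * A) = A" using assoc_mult_mat[OF A P A] A by (simp add: AP)
    have "P * A = transpose_mat ((P * A) * (Q * A))"
      unfolding assoc_mult_mat[OF P A QA] AQA' PA_sym ..
    also have "\<dots> = (Q * A) * (P * A)"
      unfolding transpose_mult[OF PA QA] QA_sym PA_sym ..
    also have "\<dots> = Q * A"
      unfolding assoc_mult_mat[OF Qc A PA] APA' ..
    finally have "P * A = Q * A" .
    then have "Q * (A * P) = P * (A * P)"
      using assoc_mult_mat[OF Qc A P] assoc_mult_mat[OF P A P] by simp
    then show "Q = P" using P Qc by (simp add: AP)
  qed
  with pinv have "pseudo_inverse A = P"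
    unfolding pseudo_inverse_def by (intro the_equality)
  then show "pseudo_inverse A \<in> carrier_mat d n" "A * pseudo_inverse A = 1\<^sub>m n"
    using P AP by simp_all
qed

lemma least_squares_recovers:
  assumes L: "L \<in> carrier_mat m n" and A: "A \<in> carrier_mat n d"
    and ind: "independent_on {..<d} n (\<lambda>l j. A $$ (l, j))"
  shows "(L * A) * pseudo_inverse A = L"
  using assoc_mult_mat[OF L A pseudo_inverse_full_row_rank(1)[OF A ind]]
    pseudo_inverse_full_row_rank(2)[OF A ind] L by simp

section \<open>What a random sample reaches\<close>

context prob_space
begin

text \<open>
  By independence and identical distribution, the first \<open>n\<close> points of sequence \<open>i\<close> all miss \<open>W i\<close>
  with probability \<open>q\<^sub>i\<^sup>n\<close>, where \<open>q\<^sub>i < 1\<close> by full support. It remains to sum over the finitely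
  many \<open>i\<close> and to take \<open>n\<close> large.
\<close>
lemma iid_samples_hit_open_sets:
  fixes X :: "'i \<Rightarrow> nat \<Rightarrow> 'a \<Rightarrow> 'b::topological_space"
  assumes I: "finite I" and iid: "\<And>i. i \<in> I \<Longrightarrow> iid_in M S (X i)"
    and supp: "\<And>i. i \<in> I \<Longrightarrow> full_support M S (X i 0)"
    and W: "\<And>i. i \<in> I \<Longrightarrow> open (W i) \<and> W i \<inter> S \<noteq> {}" and \<delta>: "\<delta> > 0"
  obtains n A where "A \<in> events" "prob A \<ge> 1 - \<delta>"
    "\<And>i \<omega>. i \<in> I \<Longrightarrow> \<omega> \<in> A \<Longrightarrow> \<exists>j<n. X i j \<omega> \<in> W i"
proof -
  define q where "q i = prob (X i 0 -` (- W i) \<inter> space M)" for i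
  define miss where "miss n i = (\<Inter>j\<in>{..<Suc n}. X i j -` (- W i) \<inter> space M)" for n i
  have rv: "X i j \<in> borel_measurable M" if "i \<in> I" for i j
    using iid[OF that] unfolding iid_in_def indep_vars_def by auto
  have Wb: "W i \<in> sets borel" "- W i \<in> sets borel" if "i \<in> I" for i using W[OF that] by auto
  have miss_ev: "miss n i \<in> events" if "i \<in> I" for n i
    unfolding miss_def using measurable_sets[OF rv[OF that] Wb(2)[OF that]] by (intro sets.finite_INT) auto
  have prob_miss: "prob (miss n i) = q i ^ Suc n" if i: "i \<in> I" for n i
  proof -
    have ind: "indep_vars (\<lambda>_. borel) (X i) UNIV" using iid[OF i] by (simp add: iid_in_def)
    have same: "prob (X i j -` (- W i) \<inter> space M) = q i" for j
    proof -
      have "prob (X i j -` (- W i) \<inter> space M) = measure (distr M borel (X i j)) (- W i)"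
        using measure_distr[OF rv[OF i] Wb(2)[OF i]] by simp
      also have "\<dots> = measure (distr M borel (X i 0)) (- W i)"
        using iid[OF i] unfolding iid_in_def by metis
      finally show ?thesis using measure_distr[OF rv[OF i] Wb(2)[OF i]] by (simp add: q_def)
    qed
    have "prob (miss n i) = (\<Prod>j\<in>{..<Suc n}. prob (X i j -` (- W i) \<inter> space M))"
      unfolding miss_def by (rule indep_varsD[OF ind]) (use Wb[OF i] in auto)
    then show ?thesis by (simp add: same)
  qed
  have q: "0 \<le> q i" "q i < 1" if i: "i \<in> I" for i
  proof -
    show "0 \<le> q i" by (simp add: q_def)
    have "prob (X i 0 -` W i \<inter> space M) > 0"
      using supp[OF i] W[OF i] by (simp add: full_support_def vimage_def Int_def conj_commute)
    moreover have "X i 0 -` (- W i) \<inter> space M = space M - (X i 0 -` W i \<inter> space M)" by auto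
    ultimately show "q i < 1"
      unfolding q_def using prob_compl[OF measurable_sets[OF rv[OF i] Wb(1)[OF i]]] by simp
  qed
  have "(\<lambda>n. \<Sum>i\<in>I. q i ^ Suc n) \<longlonglongrightarrow> (\<Sum>i\<in>I. 0)"
    using q by (intro tendsto_sum LIMSEQ_Suc LIMSEQ_realpow_zero) auto
  then have "eventually (\<lambda>n. (\<Sum>i\<in>I. q i ^ Suc n) < \<delta>) sequentially"
    using \<delta> by (intro order_tendstoD(2)[of _ "\<Sum>i\<in>I. 0"]) auto
  then obtain n where n: "(\<Sum>i\<in>I. q i ^ Suc n) < \<delta>"
    by (meson eventually_happens sequentially_bot)
  define A where "A = space M - (\<Union>i\<in>I. miss n i)"
  have Bev: "(\<Union>i\<in>I. miss n i) \<in> events" using I miss_ev by auto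
  have "prob (\<Union>i\<in>I. miss n i) \<le> (\<Sum>i\<in>I. prob (miss n i))"
    using I miss_ev by (intro finite_measure_subadditive_finite) auto
  also have "\<dots> = (\<Sum>i\<in>I. q i ^ Suc n)" using prob_miss by simp
  also have "\<dots> < \<delta>" by (rule n)
  finally have "prob A \<ge> 1 - \<delta>" unfolding A_def using prob_compl[OF Bev] by simp
  moreover have "A \<in> events" using Bev by (auto simp: A_def)
  moreover have "\<exists>j<Suc n. X i j \<omega> \<in> W i" if "i \<in> I" "\<omega> \<in> A" for i \<omega>
    using that unfolding A_def miss_def by blast
  ultimately show thesis using that by blast
qed

lemma iid_samples_stay_in_range:
  assumes I: "finite I" and iid: "\<And>i. i \<in> I \<Longrightarrow> iid_in M S (X i)"
  obtains Z where "Z \<in> null_sets M"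
    "\<And>i j \<omega>. i \<in> I \<Longrightarrow> \<omega> \<in> space M - Z \<Longrightarrow> X i j \<omega> \<in> S"
proof -
  have "AE \<omega> in M. \<forall>i\<in>I. \<forall>j. X i j \<omega> \<in> S"
    using I iid unfolding iid_in_def
    by (subst AE_ball_countable) (auto intro: countable_finite simp: AE_all_countable)
  then show thesis using that by (elim AE_E3) blast
qed

end

section \<open>Exact recovery from a sample of full rank\<close>

lemma coord_pos_less: "coord_pos (i :: 'n::finite) < CARD('n)"
  unfolding coord_pos_def using to_nat_on_finite[of "UNIV :: 'n set"] by (auto simp: bij_betw_def)

context augmented_dictionary
begin

text \<open>
  The coordinate functions belong to the dictionary, and their Lie derivatives are the
  components of the augmented field. This is why the selection \<open>P_xi\<close> reads off the system from
  the matrix of the Lie operator.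
\<close>
lemma lie_op_coordinate:
  assumes \<xi>: "\<xi> \<in> \<Xi>"
  shows "\<L> U (\<psi> (1 + coord_pos i)) \<xi> = (aug_F f \<xi> + aug_G g \<xi> *v U) $ Inl i"
    and "\<L> U (\<psi> (1 + N + coord_pos i)) \<xi> = (aug_F f \<xi> + aug_G g \<xi> *v U) $ Inr i"
proof -
  have derivative_of_coordinate: "frechet_derivative q (at \<xi>) v = v $ s"
    if "\<And>\<zeta>. \<zeta> \<in> \<Xi> \<Longrightarrow> q \<zeta> = \<zeta> $ s" for q :: "real^('n + 'n) \<Rightarrow> real" and s v
  proof -
    have "((\<lambda>\<zeta>. \<zeta> $ s) has_derivative (\<lambda>v. v $ s)) (at \<xi>)"
      by (rule bounded_linear_imp_has_derivative[OF bounded_linear_vec_nth])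
    then have "(q has_derivative (\<lambda>v. v $ s)) (at \<xi>)"
      by (rule has_derivative_transform_within_open[OF _ open_joint_set[OF open_\<Omega> open_UNIV] \<xi>])
        (simp add: that)
    then show ?thesis using frechet_derivative_at by metis
  qed
  have "\<psi> (1 + coord_pos i) \<zeta> = \<zeta> $ Inl i" if "\<zeta> \<in> \<Xi>" for \<zeta>
    using that coord_pos_less[of i] dims(1) \<phi>_coord[of "upper \<zeta>" i] by (simp add: dict_def mem_joint_set) (simp add: upper_def)
  from derivative_of_coordinate[OF this]
  show "\<L> U (\<psi> (1 + coord_pos i)) \<xi> = (aug_F f \<xi> + aug_G g \<xi> *v U) $ Inl i"
    by (simp add: lie_op_def)
  have "\<psi> (1 + N + coord_pos i) \<zeta> = \<zeta> $ Inr i" if "\<zeta> \<in> \<Xi>" for \<zeta>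
    using that a_coord[of "upper \<zeta>" i]
    by (simp add: dict_def mem_joint_set inner_axis') (simp add: lower_def)
  from derivative_of_coordinate[OF this]
  show "\<L> U (\<psi> (1 + N + coord_pos i)) \<xi> = (aug_F f \<xi> + aug_G g \<xi> *v U) $ Inr i"
    by (simp add: lie_op_def)
qed

lemma coord_index_less: "1 + coord_pos (i :: 'n) < p" "1 + N + coord_pos (i :: 'n) < p"
  using coord_pos_less[of i] dims by auto

lemma P_xi_lie_op:
  assumes \<xi>: "\<xi> \<in> \<Xi>" and v: "\<And>l. 0 < l \<Longrightarrow> l < p \<Longrightarrow> v $v l = \<L> U (\<psi> l) \<xi>"
  shows "P_xi N v = aug_F f \<xi> + aug_G g \<xi> *v U"
proof -
  have "P_xi N v $ s = (aug_F f \<xi> + aug_G g \<xi> *v U) $ s" for s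
  proof (cases s)
    case (Inl i)
    then show ?thesis
      using v[of "1 + coord_pos i"] coord_index_less(1)[of i] lie_op_coordinate(1)[OF \<xi>, of U i]
      by (simp add: P_xi_def joinv_def)
  next
    case (Inr i)
    then show ?thesis
      using v[of "1 + N + coord_pos i"] coord_index_less(2)[of i] lie_op_coordinate(2)[OF \<xi>, of U i]
      by (simp add: P_xi_def joinv_def)
  qed
  then show ?thesis by (simp add: Finite_Cartesian_Product.vec_eq_iff)
qed

text \<open>
  Independence on the set of sample points is full row rank of the data matrix. The points have to
  lie in \<open>\<Xi>\<close>, as the matrix of the Lie operator describes it only there.
\<close>
definition good_sample :: "nat \<Rightarrow> (nat \<Rightarrow> real^('n + 'n)) \<Rightarrow> bool" where
  "good_sample d w \<longleftrightarrow> (\<forall>j<d. w j \<in> \<Xi>) \<and> independent_on (w ` {..<d}) p \<psi>"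

lemma good_sample_full_row_rank:
  assumes "good_sample d w"
  shows "independent_on {..<d} p (\<lambda>l j. data_X N K \<phi> a d w $$ (l, j))"
    "independent_on {..<d} (N + K) (\<lambda>l j. hat (data_X N K \<phi> a d w) $$ (l, j))"
proof -
  have ind: "independent_on {..<d} p (\<lambda>l j. \<psi> l (w j))"
    using assms unfolding good_sample_def independent_on_def by blast
  then show "independent_on {..<d} p (\<lambda>l j. data_X N K \<phi> a d w $$ (l, j))"
    unfolding independent_on_def by (simp add: data_X_def)
  have "independent_on {..<d} (N + K) (\<lambda>l j. \<psi> (Suc l) (w j))"
    using ind by (intro independent_on_tail) simp
  then show "independent_on {..<d} (N + K) (\<lambda>l j. hat (data_X N K \<phi> a d w) $$ (l, j))"
    unfolding independent_on_def by (simp add: data_X_def hat_def)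
qed

lemma edmd_E_exact:
  assumes rep: "represents_lie_op C (axis i 1)"
    and good: "good_sample d (w (axis i 1))"
  shows "edmd_E f g N K \<phi> a i d w \<in> carrier_mat p p"
    and "\<xi> \<in> \<Xi> \<Longrightarrow> 0 < l \<Longrightarrow> l < p \<Longrightarrow>
      (edmd_E f g N K \<phi> a i d w *\<^sub>v dict_vec N K \<phi> a \<xi>) $v l = \<L> (axis i 1) (\<psi> l) \<xi>"
proof -
  have C: "\<L> (axis i 1) (\<psi> l) \<xi> = (\<Sum>k<p. C l k * \<psi> k \<xi>)" if "l < p" "\<xi> \<in> \<Xi>" for l \<xi>
    using rep that unfolding represents_lie_op_def by blast
  let ?X = "data_X N K \<phi> a d (w (axis i 1))"
  define L where "L = Matrix.mat (N + K) p (\<lambda>(l, k). C (Suc l) k)"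
  have L: "L \<in> carrier_mat (N + K) p" and X: "?X \<in> carrier_mat p d"
    by (simp_all add: L_def data_X_def)
  have "hat (data_Y f g N K \<phi> a (axis i 1) d (w (axis i 1))) = L * ?X"
  proof (rule eq_matI)
    fix l j assume "l < dim_row (L * ?X)" "j < dim_col (L * ?X)"
    then have lj: "l < N + K" "j < d" using L X by auto
    then have "hat (data_Y f g N K \<phi> a (axis i 1) d (w (axis i 1))) $$ (l, j)
        = \<L> (axis i 1) (\<psi> (Suc l)) (w (axis i 1) j)"
      by (simp add: hat_def data_Y_def)
    also have "\<dots> = (\<Sum>k<p. C (Suc l) k * \<psi> k (w (axis i 1) j))"
      using lj good by (intro C) (auto simp: good_sample_def)
    also have "\<dots> = (L * ?X) $$ (l, j)"
      using lj by (simp add: L_def data_X_def scalar_prod_def atLeast0LessThan)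
    finally show "hat (data_Y f g N K \<phi> a (axis i 1) d (w (axis i 1))) $$ (l, j) = (L * ?X) $$ (l, j)" .
  qed (simp_all add: hat_def data_Y_def data_X_def L_def)
  then have E: "edmd_E f g N K \<phi> a i d w = 0\<^sub>m 1 p @\<^sub>r L"
    using least_squares_recovers[OF L X good_sample_full_row_rank(1)[OF good]] by (simp add: edmd_E_def)
  then show "edmd_E f g N K \<phi> a i d w \<in> carrier_mat p p"
    using carrier_append_rows[OF zero_carrier_mat L, of 1] by simp
  assume \<xi>: "\<xi> \<in> \<Xi>" and l: "0 < l" "l < p"
  have "(edmd_E f g N K \<phi> a i d w *\<^sub>v dict_vec N K \<phi> a \<xi>) $v l = (\<Sum>k<p. C l k * \<psi> k \<xi>)"
    using l unfolding E append_rows_def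
    by (simp add: L_def dict_vec_def scalar_prod_def atLeast0LessThan)
  then show "(edmd_E f g N K \<phi> a i d w *\<^sub>v dict_vec N K \<phi> a \<xi>) $v l = \<L> (axis i 1) (\<psi> l) \<xi>"
    using C[OF l(2) \<xi>] by simp
qed

text \<open>
  The origin is an equilibrium of the uncontrolled augmented system.
\<close>
lemma uncontrolled_lie_op_at_0:
  assumes l: "l < p"
  shows "\<L> 0 (\<psi> l) 0 = 0"
proof -
  have "0 \<in> \<Xi>" using zero_in_\<Omega> by (simp add: mem_joint_set)
  from linear_frechet_derivative[OF dict_differentiable[OF l this]]
  have "frechet_derivative (\<psi> l) (at 0) 0 = 0" by (rule linear_0)
  moreover have "aug_F f 0 = 0"
    using f_0 by (simp add: aug_F_def joinv_def Finite_Cartesian_Product.vec_eq_iff split: sum.split)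
  ultimately show ?thesis by (simp add: lie_op_def)
qed

text \<open>
  Evaluating \<open>\<L> 0 (\<psi> l) = (\<Sum>k<p. C l k * \<psi> k)\<close> at the equilibrium \<open>0\<close> leaves only the coefficient
  of the constant function, so \<open>C l 0 = 0\<close>. Hence the regression without the constant function is
  exact as well.
\<close>
lemma edmd_0_exact:
  assumes rep: "represents_lie_op C 0"
    and good: "good_sample d (w 0)"
  shows "edmd_0 f g N K \<phi> a d w \<in> carrier_mat p p"
    and "\<xi> \<in> \<Xi> \<Longrightarrow> 0 < l \<Longrightarrow> l < p \<Longrightarrow>
      (edmd_0 f g N K \<phi> a d w *\<^sub>v dict_vec N K \<phi> a \<xi>) $v l = \<L> 0 (\<psi> l) \<xi>"
proof -
  have C: "\<L> 0 (\<psi> l) \<xi> = (\<Sum>k<p. C l k * \<psi> k \<xi>)" if "l < p" "\<xi> \<in> \<Xi>" for l \<xi>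
    using rep that unfolding represents_lie_op_def by blast
  let ?X = "hat (data_X N K \<phi> a d (w 0))"
  have split: "(\<Sum>k<p. C l k * \<psi> k \<xi>) = C l 0 + (\<Sum>k<N + K. C l (Suc k) * \<psi> (Suc k) \<xi>)" for l \<xi>
    by (simp add: sum.lessThan_Suc_shift dict_def[of N \<phi> a 0] del: sum.lessThan_Suc)
  have C0: "C l 0 = 0" if l: "l < p" for l
  proof -
    have "0 \<in> \<Xi>" using zero_in_\<Omega> by (simp add: mem_joint_set)
    moreover have "\<psi> (Suc k) 0 = 0" if "k < N + K" for k
      using \<phi>_0[of k] that by (simp add: dict_def)
    ultimately show ?thesis
      using C[OF l, of 0] uncontrolled_lie_op_at_0[OF l] unfolding split by simp
  qed
  have C': "\<L> 0 (\<psi> l) \<xi> = (\<Sum>k<N + K. C l (Suc k) * \<psi> (Suc k) \<xi>)" if "l < p" "\<xi> \<in> \<Xi>" for l \<xi>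
    using C[OF that] C0[OF that(1)] unfolding split by simp
  define L where "L = Matrix.mat (N + K) (N + K) (\<lambda>(l, k). C (Suc l) (Suc k))"
  have L: "L \<in> carrier_mat (N + K) (N + K)" and X: "?X \<in> carrier_mat (N + K) d"
    by (simp_all add: L_def data_X_def hat_def)
  have "hat (data_Y f g N K \<phi> a 0 d (w 0)) = L * ?X"
  proof (rule eq_matI)
    fix l j assume "l < dim_row (L * ?X)" "j < dim_col (L * ?X)"
    then have lj: "l < N + K" "j < d" using L X by auto
    then have "hat (data_Y f g N K \<phi> a 0 d (w 0)) $$ (l, j) = \<L> 0 (\<psi> (Suc l)) (w 0 j)"
      by (simp add: hat_def data_Y_def)
    also have "\<dots> = (\<Sum>k<N + K. C (Suc l) (Suc k) * \<psi> (Suc k) (w 0 j))"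
      using lj good by (intro C') (auto simp: good_sample_def)
    also have "\<dots> = (L * ?X) $$ (l, j)"
      using lj by (simp add: L_def data_X_def hat_def scalar_prod_def atLeast0LessThan)
    finally show "hat (data_Y f g N K \<phi> a 0 d (w 0)) $$ (l, j) = (L * ?X) $$ (l, j)" .
  qed (simp_all add: hat_def data_Y_def data_X_def L_def)
  then have E: "edmd_0 f g N K \<phi> a d w = four_block_mat (0\<^sub>m 1 1) (0\<^sub>m 1 (N + K)) (0\<^sub>m (N + K) 1) L"
    using least_squares_recovers[OF L X good_sample_full_row_rank(2)[OF good]] by (simp add: edmd_0_def)
  then show "edmd_0 f g N K \<phi> a d w \<in> carrier_mat p p"
    using four_block_carrier_mat[OF zero_carrier_mat[of 1 1] L] by simp
  assume \<xi>: "\<xi> \<in> \<Xi>" and l: "0 < l" "l < p"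
  have "(edmd_0 f g N K \<phi> a d w *\<^sub>v dict_vec N K \<phi> a \<xi>) $v l
      = (\<Sum>k<Suc (N + K). four_block_mat (0\<^sub>m 1 1) (0\<^sub>m 1 (N + K)) (0\<^sub>m (N + K) 1) L $$ (l, k) * \<psi> k \<xi>)"
    using l L unfolding E by (simp add: dict_vec_def scalar_prod_def atLeast0LessThan del: sum.lessThan_Suc)
  also have "\<dots> = (\<Sum>k<N + K. C l (Suc k) * \<psi> (Suc k) \<xi>)"
    using l by (simp add: sum.lessThan_Suc_shift L_def del: sum.lessThan_Suc)
  also have "\<dots> = \<L> 0 (\<psi> l) \<xi>" using C'[OF l(2) \<xi>] by simp
  finally show "(edmd_0 f g N K \<phi> a d w *\<^sub>v dict_vec N K \<phi> a \<xi>) $v l = \<L> 0 (\<psi> l) \<xi>" .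
qed

text \<open>
  Both regressions return the matrices of the Lie operators, so their selected rows give \<open>F\<close> and
  \<open>F + G E\<^sub>i\<close>; the difference of the two is the \<open>i\<close>-th column of \<open>G\<close>.
\<close>
lemma edmd_recovers_system:
  assumes inv: "dict_invariant \<Omega> f g \<U> N K \<phi> a" and \<U>: "open \<U>" "\<U> \<noteq> {}"
    and good: "\<And>U. U \<in> edmd_controls \<Longrightarrow> good_sample d (w U)" and \<xi>: "\<xi> \<in> \<Xi>"
  shows "F_eta f g N K \<phi> a d w \<xi> = aug_F f \<xi>" and "G_eta f g N K \<phi> a d w \<xi> = aug_G g \<xi>"
proof -
  let ?E0 = "edmd_0 f g N K \<phi> a d w" and ?\<Psi> = "dict_vec N K \<phi> a \<xi>"
  have \<Psi>: "?\<Psi> \<in> carrier_vec p" by (simp add: dict_vec_def)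
  note rep = lie_op_dict_in_span[OF inv \<U>]
  obtain C0 where C0: "represents_lie_op C0 0" using rep by blast
  have good0: "good_sample d (w 0)" by (rule good) (simp add: edmd_controls_def)
  note E0 = edmd_0_exact[where w=w, OF C0 good0]
  have P0: "P_xi N (?E0 *\<^sub>v ?\<Psi>) = aug_F f \<xi>"
    using P_xi_lie_op[OF \<xi> E0(2)[OF \<xi>]] by simp
  then show "F_eta f g N K \<phi> a d w \<xi> = aug_F f \<xi>" by (simp add: F_eta_def)
  have "G_eta f g N K \<phi> a d w \<xi> $ s $ i = aug_G g \<xi> $ s $ i" for s i
  proof -
    let ?Ei = "edmd_E f g N K \<phi> a i d w"
    obtain C where C: "represents_lie_op C (axis i 1)" using rep by blast
    have "good_sample d (w (axis i 1))" by (rule good) (simp add: edmd_controls_def)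
    note Ei = edmd_E_exact[where w=w, OF C this]
    have Pi: "P_xi N (?Ei *\<^sub>v ?\<Psi>) = aug_F f \<xi> + aug_G g \<xi> *v axis i 1"
      using P_xi_lie_op[OF \<xi> Ei(2)[OF \<xi>]] by simp
    have "P_xi N (?Ei *\<^sub>v ?\<Psi> - ?E0 *\<^sub>v ?\<Psi>) = (P_xi N (?Ei *\<^sub>v ?\<Psi>) - P_xi N (?E0 *\<^sub>v ?\<Psi>) :: real^('n + 'n))"
      using coord_index_less E0(1)
      by (auto simp: P_xi_def joinv_def Finite_Cartesian_Product.vec_eq_iff split: sum.split)
    then have "P_xi N ((?Ei - ?E0) *\<^sub>v ?\<Psi>) = aug_G g \<xi> *v axis i 1"
      unfolding minus_mult_distrib_mat_vec[OF Ei(1) E0(1) \<Psi>] P0 Pi by simp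
    then show ?thesis
      by (simp add: G_eta_def matrix_vector_mult_basis column_def)
  qed
  then show "G_eta f g N K \<phi> a d w \<xi> = aug_G g \<xi>"
    by (simp add: Finite_Cartesian_Product.vec_eq_iff)
qed

text \<open>
  For fixed \<open>x\<close> every function in the span is affine in \<open>y\<close>, so vanishing for all \<open>y\<close> in the box forces
  it to vanish for all \<open>y\<close>.
\<close>
lemma dict_independent_on_samples:
  assumes r: "r > 0"
  shows "independent_on (joint_set \<Omega> (sampling_box r)) p \<psi>"
  unfolding independent_on_def
proof (rule allI, rule impI)
  fix c assume c: "\<forall>\<xi>\<in>joint_set \<Omega> (sampling_box r). (\<Sum>l<p. c l * \<psi> l \<xi>) = 0"
  define h where "h x y = (\<Sum>l<p. c l * \<psi> l (joinv x y))" for x y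
  have h0: "h x y = 0" if "x \<in> \<Omega>" "y \<in> sampling_box r" for x y
    using c that by (simp add: h_def mem_joint_set)
  have affine: "h x (s *\<^sub>R y) = h x 0 + s * (h x y - h x 0)" for x y s
  proof -
    have eq: "\<psi> l (joinv x (s *\<^sub>R y)) = \<psi> l (joinv x 0) + s * (\<psi> l (joinv x y) - \<psi> l (joinv x 0))" for l
      by (simp add: dict_def)
    have "h x (s *\<^sub>R y) = (\<Sum>l<p. c l * \<psi> l (joinv x 0)
        + s * (c l * \<psi> l (joinv x y) - c l * \<psi> l (joinv x 0)))"
      unfolding h_def eq by (intro sum.cong refl) (simp add: algebra_simps)
    then show ?thesis
      unfolding h_def by (simp only: sum.distrib sum_distrib_left[symmetric] sum_subtractf)
  qed
  have "h x y = 0" if x: "x \<in> \<Omega>" for x y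
  proof -
    define s where "s = r / (norm y + 1)"
    have s: "s > 0" using r by (simp add: s_def add_nonneg_pos)
    have "\<bar>s * y $ i\<bar> \<le> r" for i
    proof -
      have "\<bar>s * y $ i\<bar> \<le> s * (norm y + 1)"
        using s component_le_norm_cart[of y i] by (auto simp: abs_mult intro!: mult_left_mono)
      also have "\<dots> = r" using norm_ge_zero[of y] by (simp add: s_def add_nonneg_eq_0_iff)
      finally show ?thesis .
    qed
    then have "s *\<^sub>R y \<in> sampling_box r" "0 \<in> sampling_box r"
      using r by (auto simp: sampling_box_def abs_le_iff minus_le_iff)
    then have "h x (s *\<^sub>R y) = 0" "h x 0 = 0" using h0 x by auto
    with affine[of x s y] s show ?thesis by simp
  qed
  then have "\<forall>\<xi>\<in>\<Xi>. (\<Sum>l<p. c l * \<psi> l \<xi>) = 0"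
    by (metis h_def joinv_upper_lower mem_joint_set)
  then show "\<forall>l<p. c l = 0" using independent_on_\<Xi> unfolding independent_on_def by blast
qed

text \<open>
  One event serves all sample sizes \<open>d \<ge> d0\<close>: once the first \<open>d0\<close> points hit all the required
  open sets, further points keep them hit.
\<close>
lemma good_samples_with_high_probability:
  fixes X :: "real^('m + 'm) \<Rightarrow> nat \<Rightarrow> 'w \<Rightarrow> real^('n + 'n)"
  assumes M: "prob_space M" and r: "r > 0" and \<delta>: "\<delta> > 0"
    and iid: "\<And>U. U \<in> edmd_controls \<Longrightarrow> iid_in M (joint_set \<Omega> (sampling_box r)) (X U)"
    and supp: "\<And>U. U \<in> edmd_controls \<Longrightarrow> full_support M (joint_set \<Omega> (sampling_box r)) (X U 0)"
  shows "\<exists>d0. \<exists>A\<in>sets M. measure M A \<ge> 1 - \<delta> \<and>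
    (\<forall>d\<ge>d0. \<forall>\<omega>\<in>A. \<forall>U\<in>edmd_controls. good_sample d (\<lambda>j. X U j \<omega>))"
proof -
  interpret prob_space M by (rule M)
  let ?S = "joint_set \<Omega> (sampling_box r)"
  let ?E = "edmd_controls :: (real^('m + 'm)) set"
  have fin: "finite ?E" by (simp add: edmd_controls_def)
  have S: "?S \<subseteq> \<Xi>" by (auto simp: mem_joint_set)
  have cont: "isCont (\<psi> l) \<xi>" if "l < p" "\<xi> \<in> ?S" for l \<xi>
    using dict_differentiable[of l \<xi>] that S by (auto intro: differentiable_imp_continuous_within)
  obtain T W where T: "finite T" "T \<subseteq> ?S" and W: "\<And>x. x \<in> T \<Longrightarrow> open (W x) \<and> x \<in> W x"
    and ind: "\<And>Z. (\<And>x. x \<in> T \<Longrightarrow> \<exists>z\<in>Z. z \<in> W x) \<Longrightarrow> independent_on Z p \<psi>"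
    using independence_witnessed_by_open_sets[OF dict_independent_on_samples[OF r] cont] by blast
  obtain n A where A: "A \<in> events" "prob A \<ge> 1 - \<delta>"
    and hit: "\<And>i \<omega>. i \<in> ?E \<times> T \<Longrightarrow> \<omega> \<in> A \<Longrightarrow> \<exists>j<n. X (fst i) j \<omega> \<in> W (snd i)"
  proof (rule iid_samples_hit_open_sets[of "?E \<times> T" ?S "\<lambda>i. X (fst i)" "\<lambda>i. W (snd i)" \<delta>])
    show "finite (?E \<times> T)" using fin T by simp
    show "open (W (snd i)) \<and> W (snd i) \<inter> ?S \<noteq> {}" if "i \<in> ?E \<times> T" for i
      using that W[of "snd i"] T by auto
  qed (use iid supp \<delta> in auto)
  obtain Z where Z: "Z \<in> null_sets M"
    and stay: "\<And>U j \<omega>. U \<in> ?E \<Longrightarrow> \<omega> \<in> space M - Z \<Longrightarrow> X U j \<omega> \<in> ?S"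
    using iid_samples_stay_in_range[of ?E ?S X] fin iid by blast
  show ?thesis
  proof (intro exI[of _ n] bexI[of _ "A - Z"] conjI allI ballI impI)
    show "A - Z \<in> events" using A Z by auto
    show "prob (A - Z) \<ge> 1 - \<delta>" using A Z by (simp add: measure_Diff_null_set)
    fix d \<omega> and U :: "real^('m + 'm)"
    assume d: "n \<le> d" and \<omega>: "\<omega> \<in> A - Z" and U: "U \<in> ?E"
    have "X U j \<omega> \<in> \<Xi>" for j
      using stay[OF U, of \<omega> j] \<omega> sets.sets_into_space[OF A(1)] S by blast
    moreover have "independent_on ((\<lambda>j. X U j \<omega>) ` {..<d}) p \<psi>"
    proof (rule ind)
      fix x assume "x \<in> T"
      then obtain j where "j < n" "X U j \<omega> \<in> W x" using hit[of "(U, x)" \<omega>] U \<omega> by auto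
      then show "\<exists>z\<in>(\<lambda>j. X U j \<omega>) ` {..<d}. z \<in> W x" using d by auto
    qed
    ultimately show "good_sample d (\<lambda>j. X U j \<omega>)" by (simp add: good_sample_def)
  qed
qed

end

theorem theorem4p1:
  fixes \<Omega> :: "(real^'n) set"
    and f :: "real^'n \<Rightarrow> real^'n" and g :: "real^'n \<Rightarrow> real^'m^'n"
    and Us Vs :: "(real^'m) set"
    and N K :: nat
    and \<phi> :: "nat \<Rightarrow> real^'n \<Rightarrow> real" and a :: "nat \<Rightarrow> real^'n \<Rightarrow> real^'n"
    and r :: real and M :: "'w measure"
    and X :: "real^('m + 'm) \<Rightarrow> nat \<Rightarrow> 'w \<Rightarrow> real^('n + 'n)"
    and \<delta> \<eta> :: real
  assumes "is_domain \<Omega>" "bounded \<Omega>" "piecewise_smooth_boundary \<Omega>"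
    and "0 \<in> \<Omega>" "Ck_on 2 \<Omega> f" "f 0 = 0" "Ck_on 2 \<Omega> g"
    and "is_domain Us" "is_domain Vs"
    and "CARD('n) \<le> N" "CARD('n) \<le> K"
    and "\<And>i x. x \<in> \<Omega> \<Longrightarrow> \<phi> (coord_pos i) x = x $ i"
    and "\<And>i x. x \<in> \<Omega> \<Longrightarrow> a (coord_pos i) x = axis i 1"
    and "\<And>k. k < N \<Longrightarrow> Ck_on_closure 2 \<Omega> (\<phi> k)" "\<And>k. k < N \<Longrightarrow> \<phi> k 0 = 0"
    and "\<And>k. k < K \<Longrightarrow> smooth_on \<Omega> (a k)"
    and "dict_independent \<Omega> N K \<phi> a"
    and "dict_invariant \<Omega> f g (joint_set Us Vs) N K \<phi> a"
    and "r > 0" and "prob_space M"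
    and "\<And>U. U \<in> edmd_controls \<Longrightarrow> iid_in M (joint_set \<Omega> (sampling_box r)) (X U)"
    and "\<And>U. U \<in> edmd_controls \<Longrightarrow> full_support M (joint_set \<Omega> (sampling_box r)) (X U 0)"
    and "0 < \<delta>" "\<delta> < 1" "0 < \<eta>"
  shows "\<exists>d0. \<forall>d\<ge>d0. \<exists>A\<in>sets M. measure M A \<ge> 1 - \<delta> \<and>
    (\<forall>\<omega>\<in>A. \<exists>(\<alpha> :: real^('n + 'n) \<Rightarrow> real^('n + 'n)) (\<beta> :: real^('n + 'n) \<Rightarrow> real^('m + 'm)^('n + 'n))
        (\<alpha>1 :: real^'n \<Rightarrow> real^'n) (\<alpha>2 :: real^'n \<Rightarrow> real^'n^'n)
        (\<beta>1 :: real^'n \<Rightarrow> real^'m^'n) (\<beta>2 :: real^'n \<Rightarrow> real^'n^'n^'m).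
      let w = (\<lambda>U j. X U j \<omega>) in
      (\<forall>\<xi>\<in>joint_set \<Omega> UNIV. \<forall>U.
         aug_F f \<xi> + aug_G g \<xi> *v U =
           (F_eta f g N K \<phi> a d w \<xi> + \<alpha> \<xi>) + (G_eta f g N K \<phi> a d w \<xi> + \<beta> \<xi>) *v U) \<and>
      (\<forall>x\<in>\<Omega>. \<forall>y.
         \<alpha> (joinv x y) = joinv (\<alpha>1 x) (Finite_Cartesian_Product.transpose (\<alpha>2 x) *v y) \<and>
         \<beta> (joinv x y) = block_diag (\<beta>1 x) (tuple_transpose_times (\<beta>2 x) y)) \<and>
      (\<forall>x\<in>\<Omega>. norm (\<alpha>1 x) \<le> \<eta> * norm x \<and> norm (\<alpha>2 x) \<le> \<eta> \<and>
         norm (\<beta>1 x) \<le> \<eta> \<and> norm (\<beta>2 x) \<le> \<eta>))"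
proof -
  interpret augmented_dictionary \<Omega> f g N K \<phi> a
  proof unfold_locales
    show "open \<Omega>" using assms(1) by (simp add: is_domain_def)
    show "0 \<in> \<Omega>" "Ck_on 2 \<Omega> f" "f 0 = 0" "Ck_on 2 \<Omega> g" "CARD('n) \<le> N" "CARD('n) \<le> K"
      "dict_independent \<Omega> N K \<phi> a"
      by (fact assms)+
    show "\<phi> (coord_pos i) x = x $ i" "a (coord_pos i) x = axis i 1" if "x \<in> \<Omega>" for i x
      by (fact assms(12,13)[OF that])+
    show "\<phi> k 0 = 0" if "k < N" for k by (fact assms(15)[OF that])
    show "\<phi> k differentiable (at x)" if "k < N" "x \<in> \<Omega>" for k x
      using assms(14)[OF that(1)] that(2) by (simp add: numeral_2_eq_2)
    show "a k differentiable (at x)" if "k < K" "x \<in> \<Omega>" for k x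
    proof -
      have "Ck_on (Suc 0) \<Omega> (a k)" using assms(16)[OF that(1)] unfolding smooth_on_def by blast
      then show ?thesis using that(2) by simp
    qed
  qed
  have \<U>: "open (joint_set Us Vs)" "joint_set Us Vs \<noteq> {}"
    using assms(8,9) by (auto simp: is_domain_def joint_set_def intro!: open_joint_set[unfolded joint_set_def])
  have "\<exists>d0. \<exists>A\<in>sets M. measure M A \<ge> 1 - \<delta> \<and>
      (\<forall>d\<ge>d0. \<forall>\<omega>\<in>A. \<forall>U\<in>edmd_controls. good_sample d (\<lambda>j. X U j \<omega>))"
    using assms(21,22) by (rule good_samples_with_high_probability[OF assms(20,19,23)])
  then obtain d0 A where A: "A \<in> sets M" "measure M A \<ge> 1 - \<delta>"
    and good: "\<forall>d\<ge>d0. \<forall>\<omega>\<in>A. \<forall>U\<in>edmd_controls. good_sample d (\<lambda>j. X U j \<omega>)"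
    by (elim exE bexE conjE)
  show ?thesis
  proof (intro exI[of _ d0] allI impI bexI[of _ A] conjI ballI A)
    fix d \<omega> assume d: "d0 \<le> d" and \<omega>: "\<omega> \<in> A"
    have sample: "good_sample d (\<lambda>j. X U j \<omega>)" if "U \<in> edmd_controls" for U
      using good d \<omega> that by blast
    have exact: "F_eta f g N K \<phi> a d (\<lambda>U j. X U j \<omega>) \<xi> = aug_F f \<xi>"
      "G_eta f g N K \<phi> a d (\<lambda>U j. X U j \<omega>) \<xi> = aug_G g \<xi>" if "\<xi> \<in> \<Xi>" for \<xi>
      by (intro edmd_recovers_system[OF assms(18) \<U>] sample that; assumption)+
    show "\<exists>(\<alpha> :: real^('n + 'n) \<Rightarrow> real^('n + 'n)) (\<beta> :: real^('n + 'n) \<Rightarrow> real^('m + 'm)^('n + 'n))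
        (\<alpha>1 :: real^'n \<Rightarrow> real^'n) (\<alpha>2 :: real^'n \<Rightarrow> real^'n^'n)
        (\<beta>1 :: real^'n \<Rightarrow> real^'m^'n) (\<beta>2 :: real^'n \<Rightarrow> real^'n^'n^'m).
      let w = (\<lambda>U j. X U j \<omega>) in
      (\<forall>\<xi>\<in>joint_set \<Omega> UNIV. \<forall>U.
         aug_F f \<xi> + aug_G g \<xi> *v U =
           (F_eta f g N K \<phi> a d w \<xi> + \<alpha> \<xi>) + (G_eta f g N K \<phi> a d w \<xi> + \<beta> \<xi>) *v U) \<and>
      (\<forall>x\<in>\<Omega>. \<forall>y.
         \<alpha> (joinv x y) = joinv (\<alpha>1 x) (Finite_Cartesian_Product.transpose (\<alpha>2 x) *v y) \<and>
         \<beta> (joinv x y) = block_diag (\<beta>1 x) (tuple_transpose_times (\<beta>2 x) y)) \<and>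
      (\<forall>x\<in>\<Omega>. norm (\<alpha>1 x) \<le> \<eta> * norm x \<and> norm (\<alpha>2 x) \<le> \<eta> \<and>
         norm (\<beta>1 x) \<le> \<eta> \<and> norm (\<beta>2 x) \<le> \<eta>)"
      unfolding Let_def
      \<comment> \<open>The recovery is exact, so all six error terms are zero.\<close>
      by (intro exI[of _ "\<lambda>_. 0"]) (use assms(25) in \<open>simp add: exact\<close>)
  qed
qed

end
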